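(* (Simulation of More Precise Programs.) Fix any CastStructWithPrecision. Let $M_1:\emptyset\vdash' A$, $M_1':\emptyset\vdash' A'$ and $M_2':\emptyset\vdash' A'$ be terms of $CC'(\Rightarrow)$. If $M_1\sqsubseteq^C M_1'$ and $M_1'\longrightarrow M_2'$, then there exists $M_2$ such that $M_1\longrightarrow^{*}M_2$ and $M_2\sqsubseteq^C M_2'$.
   Context: **Types.** Base types $b$: $\mathtt{Nat},\mathtt{Bool},\mathtt{Int},\mathtt{Unit},\bot$. Types: $A,B::=b\mid\,?\mid A\to B\mid A\times B\mid A+B$. Contexts $\Gamma$ are finite sequences of types; variables are de Bruijn indices (index $0$ is the last-added type). Primitive types $P::=b\mid b\to P$; each $b$ denotes a set (naturals, Booleans, integers, one-element set, empty set) and $[\![b\to P]\!]$ is the set of functions $[\![b]\!]\to[\![P]\!]$. Blame labels $\ell$ range over a fixed set. **Type precision** $\sqsubseteq$: $?\sqsubseteq A$; $b\sqsubseteq b$; $A\otimes B\sqsubseteq A'\otimes B'$ if $A\sqsubseteq A'$ and $B\sqsubseteq B'$, for $\otimes\in\{\to,\times,+\}$. **PreCastStruct**: for all types $A,B$ a set $A\Rightarrow B$ of casts; predicates $\mathsf{Inert}$, $\mathsf{Active}$, $\mathsf{Cross}$ on casts; every cast is active or inert; every inert cast $c:A\Rightarrow(B\otimes C)$ with $\otimes\in\{\to,\times,+\}$ is a cross cast and $A=A_1\otimes A_2$ for some $A_1,A_2$; no cast into a base type is inert; and operations taking a cast $c$ and a proof $x$ of $\mathsf{Cross}\,c$: for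 $c:(A_1\to A_2)\Rightarrow(B_1\to B_2)$, $\mathsf{dom}\,c\,x:B_1\Rightarrow A_1$ and $\mathsf{cod}\,c\,x:A_2\Rightarrow B_2$; for $c:(A_1\times A_2)\Rightarrow(B_1\times B_2)$, $\mathsf{fst}\,c\,x:A_1\Rightarrow B_1$ and $\mathsf{snd}\,c\,x:A_2\Rightarrow B_2$; for $c:(A_1+A_2)\Rightarrow(B_1+B_2)$, $\mathsf{inl}\,c\,x:A_1\Rightarrow B_1$ and $\mathsf{inr}\,c\,x:A_2\Rightarrow B_2$. A **CastStruct** adds, for each value $V:\Gamma\vdash' A$, cast $c:A\Rightarrow B$ and $a:\mathsf{Active}\,c$, a term $\mathsf{applyCast}\,V\,c\,a:\Gamma\vdash' B$. **Terms** of $CC'(\Rightarrow)$ (intrinsically typed; $M:\Gamma\vdash' A$): $\$k:P$ for $k\in[\![P]\!]$; $`x:A$ if $x$ has type $A$ in $\Gamma$; $\lambda M:A\to B$ if $M:\Gamma\cdot A\vdash' B$; $L\,M:B$ if $L:A\to B$, $M:A$; $\mathtt{if}\,L\,M\,N:B$ if $L:\mathtt{Bool}$, $M,N:B$; $\mathtt{cons}\,M\,N:A\times B$; $\pi_iM:A_i$ if $M:A_1\times A_2$; $\mathtt{inl}[B]M:A+B$ if $M:A$; $\mathtt{inr}[A]M:A+B$ if $M:B$; $\mathtt{case}\,L\,M\,N:B$ if $L:\Gamma\vdash' A_1+A_2$, $M:\Gamma\cdot A_1\vdash' B$, $N:\Gamma\cdot A_2\vdash' B$; $M\langle c\rangle:B$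 if $M:A$, $c:A\Rightarrow B$; $M\langle\!\langle c\rangle\!\rangle:B$ if $M:A$, $c:A\Rightarrow B$ and $c$ is inert; $\mathtt{blame}\,\ell:A$ for every $A$. **Values** $V,W$: $\lambda M$; $\$k$; $\mathtt{cons}\,V\,W$; $\mathtt{inl}[B]V$; $\mathtt{inr}[A]V$; $V\langle\!\langle c\rangle\!\rangle$ ($c$ inert). **Frames** $F$: $\Box\,M$; $V\,\Box$; $\mathtt{if}\,\Box\,M\,N$; $\mathtt{cons}\,V\,\Box$; $\mathtt{cons}\,\Box\,N$; $\pi_i\Box$; $\mathtt{inl}[B]\Box$; $\mathtt{inr}[A]\Box$; $\mathtt{case}\,\Box\,M\,N$; $\Box\langle c\rangle$; $\Box\langle\!\langle c\rangle\!\rangle$. **Reduction** ($M[N]$ is substitution of $N$ for variable $0$, lowering the other free indices): - $F[M]\longrightarrow F[M']$ if $M\longrightarrow M'$; $F[\mathtt{blame}\,\ell]\longrightarrow\mathtt{blame}\,\ell$. - $V\langle c\rangle\longrightarrow\mathsf{applyCast}\,V\,c\,a$ for $a:\mathsf{Active}\,c$; $V\langle c\rangle\longrightarrow V\langle\!\langle c\rangle\!\rangle$ for $c$ inert. - For $c$ inert and $x:\mathsf{Cross}\,c$: $V\langle\!\langle c\rangle\!\rangle\,W\longrightarrow(V\,(W\langle\mathsf{dom}\,c\,x\rangle))\langle\mathsf{cod}\,c\,x\rangle$; $\pi_1(V\langle\!\langle c\rangle\!\rangle)\longrightarrow(\pi_1V)\langle\mathsf{fst}\,c\,x\rangle$;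 $\pi_2(V\langle\!\langle c\rangle\!\rangle)\longrightarrow(\pi_2V)\langle\mathsf{snd}\,c\,x\rangle$; $\mathtt{case}\,(V\langle\!\langle c\rangle\!\rangle)\,M\,N\longrightarrow\mathtt{case}\,V\,M'\,N'$, where $M'$ is $M$ with its bound variable $`0$ replaced by $`0\langle\mathsf{inl}\,c\,x\rangle$ and $N'$ is $N$ with its bound variable $`0$ replaced by $`0\langle\mathsf{inr}\,c\,x\rangle$. - $(\lambda M)\,V\longrightarrow M[V]$; $\mathtt{if}\,\$\mathtt{true}\,M\,N\longrightarrow M$; $\mathtt{if}\,\$\mathtt{false}\,M\,N\longrightarrow N$; $\pi_1(\mathtt{cons}\,V\,W)\longrightarrow V$; $\pi_2(\mathtt{cons}\,V\,W)\longrightarrow W$; $\mathtt{case}\,(\mathtt{inl}[B]V)\,M\,N\longrightarrow M[V]$; $\mathtt{case}\,(\mathtt{inr}[A]V)\,M\,N\longrightarrow N[V]$; $\$k\,\$k'\longrightarrow\$(k(k'))$. $\longrightarrow^{*}$ is the reflexive-transitive closure. **PreCastStructWithPrecision**: a PreCastStruct with three relations: $\langle\!\langle i\rangle\!\rangle\sqsubseteq\langle\!\langle i'\rangle\!\rangle$ between inert casts, $\langle\!\langle i\rangle\!\rangle\sqsubseteq A'$ between an inert cast and a type, $A\sqsubseteq\langle\!\langle i'\rangle\!\rangle$ between a type and an inert cast, such that for inert $i:A\Rightarrow B$ and $i':A'\Rightarrow B'$: (a) if $A\sqsubseteq C'$ and $B\sqsubseteq C'$ then $\langle\!\langle i\rangle\!\rangle\sqsubseteq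 C'$; (b) if $\langle\!\langle i\rangle\!\rangle\sqsubseteq\langle\!\langle i'\rangle\!\rangle$ then $A\sqsubseteq A'$ and $B\sqsubseteq B'$; (c) if $\langle\!\langle i\rangle\!\rangle\sqsubseteq C'$ then $A\sqsubseteq C'$ and $B\sqsubseteq C'$; (d) if $C\sqsubseteq\langle\!\langle i'\rangle\!\rangle$ then $C\sqsubseteq A'$ and $C\sqsubseteq B'$. **Term precision** $M\sqsubseteq^C M'$ (inductively, for $M:\Gamma\vdash' A$-style typed terms): - $\$k\sqsubseteq^C\$k$; $`x\sqsubseteq^C`x$. - $\lambda N\sqsubseteq^C\lambda N'$ if $N\sqsubseteq^C N'$ and the domain types satisfy $A\sqsubseteq A'$. - Congruence for application, $\mathtt{if}$, $\mathtt{cons}$, $\pi_1$, $\pi_2$; for $\mathtt{inl}[B]M\sqsubseteq^C\mathtt{inl}[B']M'$ additionally $B\sqsubseteq B'$; for $\mathtt{inr}[A]M\sqsubseteq^C\mathtt{inr}[A']M'$ additionally $A\sqsubseteq A'$; for $\mathtt{case}\,L\,M\,N\sqsubseteq^C\mathtt{case}\,L'\,M'\,N'$ with $L:A_1+A_2$, $L':A_1'+A_2'$ additionally $A_1\sqsubseteq A_1'$ and $A_2\sqsubseteq A_2'$. - (Cast) $M\langle c\rangle\sqsubseteq^C M'\langle c'\rangle$ if $M\sqsubseteq^C M'$, $c:A\Rightarrow B$, $c':A'\Rightarrow B'$, $A\sqsubseteq A'$, $B\sqsubseteq B'$. - (CastL) $M\langle c\rangle\sqsubseteq^C M'$ if $M\sqsubseteq^C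 M'$, $c:A\Rightarrow B$, $M'$ has type $A'$, $A\sqsubseteq A'$, $B\sqsubseteq A'$. - (CastR) $M\sqsubseteq^C M'\langle c'\rangle$ if $M\sqsubseteq^C M'$, $M$ has type $A$, $c':A'\Rightarrow B'$, $A\sqsubseteq A'$, $A\sqsubseteq B'$. - (Wrap) $M\langle\!\langle i\rangle\!\rangle\sqsubseteq^C M'\langle\!\langle i'\rangle\!\rangle$ if $M\sqsubseteq^C M'$, $\langle\!\langle i\rangle\!\rangle\sqsubseteq\langle\!\langle i'\rangle\!\rangle$, $i:A\Rightarrow B$, $i':A'\Rightarrow B'$, and ($B=\,?$ implies $B'=\,?$). - (WrapL) $M\langle\!\langle i\rangle\!\rangle\sqsubseteq^C M'$ if $M\sqsubseteq^C M'$, $M'$ has type $A'$, $\langle\!\langle i\rangle\!\rangle\sqsubseteq A'$. - (WrapR) $M\sqsubseteq^C M'\langle\!\langle i'\rangle\!\rangle$ if $M\sqsubseteq^C M'$, $M$ has type $A\neq\,?$, $A\sqsubseteq\langle\!\langle i'\rangle\!\rangle$. - (Blame) $M\sqsubseteq^C\mathtt{blame}\,\ell$ if $M$ has type $A$, $\mathtt{blame}\,\ell$ has type $A'$ and $A\sqsubseteq A'$. **CastStructWithPrecision**: a CastStruct on $CC'(\Rightarrow)$ whose PreCastStruct is a PreCastStructWithPrecision, such that, for all values $V,V'$ of types $A,A'$ with $V\sqsubseteq^C V'$ and $A\sqsubseteq A'$ (closed values in items 2–5, values in arbitrary contexts $\Gamma,\Gamma'$ in item 1): 1. for $c:A\Rightarrow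 B$, $a:\mathsf{Active}\,c$ with $B\sqsubseteq A'$, there is a value $W$ with $\mathsf{applyCast}\,V\,c\,a\longrightarrow^{*}W$ and $W\sqsubseteq^C V'$; 2. for $c:A\Rightarrow B$, $c':A'\Rightarrow B'$, $a':\mathsf{Active}\,c'$ with $B\sqsubseteq B'$, there is $N$ with $V\langle c\rangle\longrightarrow^{*}N$ and $N\sqsubseteq^C\mathsf{applyCast}\,V'\,c'\,a'$; 3. for $c:A\Rightarrow B$ and inert $c':A'\Rightarrow B'$ with $B\sqsubseteq B'$, there is $N$ with $V\langle c\rangle\longrightarrow^{*}N$ and $N\sqsubseteq^C V'\langle\!\langle c'\rangle\!\rangle$; 4. for $c':A'\Rightarrow B'$, $a':\mathsf{Active}\,c'$ with $A\sqsubseteq B'$: $V\sqsubseteq^C\mathsf{applyCast}\,V'\,c'\,a'$; 5. for inert $c':A'\Rightarrow B'$ with $A\sqsubseteq B'$: $V\sqsubseteq^C V'\langle\!\langle c'\rangle\!\rangle$. *)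

theory Defs
  imports Main
begin

section \<open>Types and type precision\<close>

datatype base = BNat | BBool | BInt | BUnit | BBot

datatype ty =
    TBase base
  | Dyn
  | TFun ty ty
  | TProd ty ty
  | TSum ty ty

text \<open>Index 0 of a context is the most recently added type.\<close>

type_synonym ctx = "ty list"

inductive ty_prec :: "ty \<Rightarrow> ty \<Rightarrow> bool"  (infix "\<sqsubseteq>" 50) where
  dyn: "Dyn \<sqsubseteq> A"
| base: "TBase b \<sqsubseteq> TBase b"
| fn: "A \<sqsubseteq> A' \<Longrightarrow> B \<sqsubseteq> B' \<Longrightarrow> TFun A B \<sqsubseteq> TFun A' B'"
| prod: "A \<sqsubseteq> A' \<Longrightarrow> B \<sqsubseteq> B' \<Longrightarrow> TProd A B \<sqsubseteq> TProd A' B'"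
| sum: "A \<sqsubseteq> A' \<Longrightarrow> B \<sqsubseteq> B' \<Longrightarrow> TSum A B \<sqsubseteq> TSum A' B'"


section \<open>Primitive types and constants\<close>

datatype prim = PBase base | PFun base prim

primrec prim_ty :: "prim \<Rightarrow> ty" where
  "prim_ty (PBase b) = TBase b"
| "prim_ty (PFun b P) = TFun (TBase b) (prim_ty P)"

text \<open>
  The elements of all the sets denoted by primitive types, as one type.  There is one constructor of
  functions for each base type, so that equality of functions is extensional equality on exactly
  the set denoted by that base type.  The function set of \<open>PFun BBot P\<close> has a single element, the
  empty function; it is tagged with \<open>P\<close> so that every constant belongs to exactly one primitive type.
\<close>

datatype const =
    KNat nat
  | KBool bool
  | KInt int
  | KUnit
  | KFunNat "nat \<Rightarrow> const"
  | KFunBool "bool \<Rightarrow> const"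
  | KFunInt "int \<Rightarrow> const"
  | KFunUnit "unit \<Rightarrow> const"
  | KFunBot prim

primrec denote_base :: "base \<Rightarrow> const set" where
  "denote_base BNat = range KNat"
| "denote_base BBool = range KBool"
| "denote_base BInt = range KInt"
| "denote_base BUnit = {KUnit}"
| "denote_base BBot = {}"

primrec denote :: "prim \<Rightarrow> const set" where
  "denote (PBase b) = denote_base b"
| "denote (PFun b P) =
    (case b of
       BNat \<Rightarrow> {KFunNat f | f. \<forall>n. f n \<in> denote P}
     | BBool \<Rightarrow> {KFunBool f | f. \<forall>n. f n \<in> denote P}
     | BInt \<Rightarrow> {KFunInt f | f. \<forall>n. f n \<in> denote P}
     | BUnit \<Rightarrow> {KFunUnit f | f. \<forall>n. f n \<in> denote P}
     | BBot \<Rightarrow> {KFunBot P})"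

fun const_app :: "const \<Rightarrow> const \<Rightarrow> const option" where
  "const_app (KFunNat f) (KNat n) = Some (f n)"
| "const_app (KFunBool f) (KBool n) = Some (f n)"
| "const_app (KFunInt f) (KInt n) = Some (f n)"
| "const_app (KFunUnit f) KUnit = Some (f ())"
| "const_app _ _ = None"


section \<open>Terms\<close>

text \<open>
  Raw terms carry enough annotations for a raw term to have at most one type in a given context
  (\<open>typed_unique\<close> below).  An intrinsically typed term of type \<open>A\<close> in context \<open>\<Gamma>\<close> is thus a raw term
  \<open>M\<close> with \<open>typed S \<Gamma> M A\<close>.  \<open>Cast\<close> is the cast still to be performed and \<open>Wrap\<close> the inert cast
  that forms a value.
\<close>

datatype ('c, 'l) tm =
    Const const
  | Var nat
  | Lam ty "('c, 'l) tm"
  | App "('c, 'l) tm" "('c, 'l) tm"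
  | Cond "('c, 'l) tm" "('c, 'l) tm" "('c, 'l) tm"
  | Tup "('c, 'l) tm" "('c, 'l) tm"
  | Proj1 "('c, 'l) tm"
  | Proj2 "('c, 'l) tm"
  | InL ty "('c, 'l) tm"
  | InR ty "('c, 'l) tm"
  | Case "('c, 'l) tm" "('c, 'l) tm" "('c, 'l) tm"
  | Cast "('c, 'l) tm" 'c
  | Wrap "('c, 'l) tm" 'c
  | Blame ty 'l

fun ext :: "(nat \<Rightarrow> nat) \<Rightarrow> nat \<Rightarrow> nat" where
  "ext \<rho> 0 = 0"
| "ext \<rho> (Suc n) = Suc (\<rho> n)"

primrec rename :: "(nat \<Rightarrow> nat) \<Rightarrow> ('c, 'l) tm \<Rightarrow> ('c, 'l) tm" where
  "rename \<rho> (Const k) = Const k"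
| "rename \<rho> (Var x) = Var (\<rho> x)"
| "rename \<rho> (Lam A M) = Lam A (rename (ext \<rho>) M)"
| "rename \<rho> (App L M) = App (rename \<rho> L) (rename \<rho> M)"
| "rename \<rho> (Cond L M N) = Cond (rename \<rho> L) (rename \<rho> M) (rename \<rho> N)"
| "rename \<rho> (Tup M N) = Tup (rename \<rho> M) (rename \<rho> N)"
| "rename \<rho> (Proj1 M) = Proj1 (rename \<rho> M)"
| "rename \<rho> (Proj2 M) = Proj2 (rename \<rho> M)"
| "rename \<rho> (InL B M) = InL B (rename \<rho> M)"
| "rename \<rho> (InR A M) = InR A (rename \<rho> M)"
| "rename \<rho> (Case L M N) = Case (rename \<rho> L) (rename (ext \<rho>) M) (rename (ext \<rho>) N)"
| "rename \<rho> (Cast M c) = Cast (rename \<rho> M) c"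
| "rename \<rho> (Wrap M c) = Wrap (rename \<rho> M) c"
| "rename \<rho> (Blame A l) = Blame A l"

fun exts :: "(nat \<Rightarrow> ('c, 'l) tm) \<Rightarrow> nat \<Rightarrow> ('c, 'l) tm" where
  "exts \<sigma> 0 = Var 0"
| "exts \<sigma> (Suc n) = rename Suc (\<sigma> n)"

primrec subst :: "(nat \<Rightarrow> ('c, 'l) tm) \<Rightarrow> ('c, 'l) tm \<Rightarrow> ('c, 'l) tm" where
  "subst \<sigma> (Const k) = Const k"
| "subst \<sigma> (Var x) = \<sigma> x"
| "subst \<sigma> (Lam A M) = Lam A (subst (exts \<sigma>) M)"
| "subst \<sigma> (App L M) = App (subst \<sigma> L) (subst \<sigma> M)"
| "subst \<sigma> (Cond L M N) = Cond (subst \<sigma> L) (subst \<sigma> M) (subst \<sigma> N)"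
| "subst \<sigma> (Tup M N) = Tup (subst \<sigma> M) (subst \<sigma> N)"
| "subst \<sigma> (Proj1 M) = Proj1 (subst \<sigma> M)"
| "subst \<sigma> (Proj2 M) = Proj2 (subst \<sigma> M)"
| "subst \<sigma> (InL B M) = InL B (subst \<sigma> M)"
| "subst \<sigma> (InR A M) = InR A (subst \<sigma> M)"
| "subst \<sigma> (Case L M N) = Case (subst \<sigma> L) (subst (exts \<sigma>) M) (subst (exts \<sigma>) N)"
| "subst \<sigma> (Cast M c) = Cast (subst \<sigma> M) c"
| "subst \<sigma> (Wrap M c) = Wrap (subst \<sigma> M) c"
| "subst \<sigma> (Blame A l) = Blame A l"

definition subst0 :: "('c, 'l) tm \<Rightarrow> ('c, 'l) tm \<Rightarrow> ('c, 'l) tm" where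
  "subst0 M N = subst (\<lambda>x. case x of 0 \<Rightarrow> N | Suc y \<Rightarrow> Var y) M"

text \<open>Variable 0 is replaced by itself under the cast \<open>c\<close>; no other variable changes.\<close>

definition cast_var0 :: "'c \<Rightarrow> ('c, 'l) tm \<Rightarrow> ('c, 'l) tm" where
  "cast_var0 c M = subst (\<lambda>x. if x = 0 then Cast (Var 0) c else Var x) M"


section \<open>Cast structures\<close>

text \<open>
  The family of sets of casts, indexed by source and target type, is given as its disjoint union
  \<open>'c\<close> together with the projections \<open>src\<close> and \<open>tgt\<close>.  \<open>Active S c a\<close> says that \<open>a\<close> is a proof that
  \<open>c\<close> is active, and \<open>Cross S c x\<close> that \<open>x\<close> is a proof that \<open>c\<close> is a cross cast; the operations below
  may depend on these proofs.
\<close>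

record ('c, 'a, 'x) pre_cast_struct =
  src :: "'c \<Rightarrow> ty"
  tgt :: "'c \<Rightarrow> ty"
  Inert :: "'c \<Rightarrow> bool"
  Active :: "'c \<Rightarrow> 'a \<Rightarrow> bool"
  Cross :: "'c \<Rightarrow> 'x \<Rightarrow> bool"
  dom_cast :: "'c \<Rightarrow> 'x \<Rightarrow> 'c"
  cod_cast :: "'c \<Rightarrow> 'x \<Rightarrow> 'c"
  fst_cast :: "'c \<Rightarrow> 'x \<Rightarrow> 'c"
  snd_cast :: "'c \<Rightarrow> 'x \<Rightarrow> 'c"
  inl_cast :: "'c \<Rightarrow> 'x \<Rightarrow> 'c"
  inr_cast :: "'c \<Rightarrow> 'x \<Rightarrow> 'c"

definition is_cast :: "('c, 'a, 'x, 'm) pre_cast_struct_scheme \<Rightarrow> 'c \<Rightarrow> ty \<Rightarrow> ty \<Rightarrow> bool" where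
  "is_cast S c A B \<longleftrightarrow> src S c = A \<and> tgt S c = B"

locale pre_cast_struct =
  fixes S :: "('c, 'a, 'x, 'm) pre_cast_struct_scheme"
  assumes active_or_inert: "(\<exists>a. Active S c a) \<or> Inert S c"
    and inert_fun: "is_cast S c A (TFun B C) \<Longrightarrow> Inert S c \<Longrightarrow>
          (\<exists>x. Cross S c x) \<and> (\<exists>A1 A2. A = TFun A1 A2)"
    and inert_prod: "is_cast S c A (TProd B C) \<Longrightarrow> Inert S c \<Longrightarrow>
          (\<exists>x. Cross S c x) \<and> (\<exists>A1 A2. A = TProd A1 A2)"
    and inert_sum: "is_cast S c A (TSum B C) \<Longrightarrow> Inert S c \<Longrightarrow>
          (\<exists>x. Cross S c x) \<and> (\<exists>A1 A2. A = TSum A1 A2)"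
    and base_not_inert: "is_cast S c A (TBase b) \<Longrightarrow> \<not> Inert S c"
    and dom_cast: "is_cast S c (TFun A1 A2) (TFun B1 B2) \<Longrightarrow> Cross S c x \<Longrightarrow>
          is_cast S (dom_cast S c x) B1 A1"
    and cod_cast: "is_cast S c (TFun A1 A2) (TFun B1 B2) \<Longrightarrow> Cross S c x \<Longrightarrow>
          is_cast S (cod_cast S c x) A2 B2"
    and fst_cast: "is_cast S c (TProd A1 A2) (TProd B1 B2) \<Longrightarrow> Cross S c x \<Longrightarrow>
          is_cast S (fst_cast S c x) A1 B1"
    and snd_cast: "is_cast S c (TProd A1 A2) (TProd B1 B2) \<Longrightarrow> Cross S c x \<Longrightarrow>
          is_cast S (snd_cast S c x) A2 B2"
    and inl_cast: "is_cast S c (TSum A1 A2) (TSum B1 B2) \<Longrightarrow> Cross S c x \<Longrightarrow>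
          is_cast S (inl_cast S c x) A1 B1"
    and inr_cast: "is_cast S c (TSum A1 A2) (TSum B1 B2) \<Longrightarrow> Cross S c x \<Longrightarrow>
          is_cast S (inr_cast S c x) A2 B2"

inductive typed :: "('c, 'a, 'x, 'm) pre_cast_struct_scheme \<Rightarrow> ctx \<Rightarrow> ('c, 'l) tm \<Rightarrow> ty \<Rightarrow> bool"
  for S where
  Const: "k \<in> denote P \<Longrightarrow> typed S \<Gamma> (Const k) (prim_ty P)"
| Var: "x < length \<Gamma> \<Longrightarrow> \<Gamma> ! x = A \<Longrightarrow> typed S \<Gamma> (Var x) A"
| Lam: "typed S (A # \<Gamma>) M B \<Longrightarrow> typed S \<Gamma> (Lam A M) (TFun A B)"
| App: "typed S \<Gamma> L (TFun A B) \<Longrightarrow> typed S \<Gamma> M A \<Longrightarrow> typed S \<Gamma> (App L M) B"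
| Cond: "typed S \<Gamma> L (TBase BBool) \<Longrightarrow> typed S \<Gamma> M B \<Longrightarrow> typed S \<Gamma> N B \<Longrightarrow> typed S \<Gamma> (Cond L M N) B"
| Tup: "typed S \<Gamma> M A \<Longrightarrow> typed S \<Gamma> N B \<Longrightarrow> typed S \<Gamma> (Tup M N) (TProd A B)"
| Proj1: "typed S \<Gamma> M (TProd A B) \<Longrightarrow> typed S \<Gamma> (Proj1 M) A"
| Proj2: "typed S \<Gamma> M (TProd A B) \<Longrightarrow> typed S \<Gamma> (Proj2 M) B"
| InL: "typed S \<Gamma> M A \<Longrightarrow> typed S \<Gamma> (InL B M) (TSum A B)"
| InR: "typed S \<Gamma> M B \<Longrightarrow> typed S \<Gamma> (InR A M) (TSum A B)"
| Case: "typed S \<Gamma> L (TSum A1 A2) \<Longrightarrow> typed S (A1 # \<Gamma>) M B \<Longrightarrow> typed S (A2 # \<Gamma>) N B \<Longrightarrow>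
    typed S \<Gamma> (Case L M N) B"
| Cast: "typed S \<Gamma> M A \<Longrightarrow> is_cast S c A B \<Longrightarrow> typed S \<Gamma> (Cast M c) B"
| Wrap: "typed S \<Gamma> M A \<Longrightarrow> is_cast S c A B \<Longrightarrow> Inert S c \<Longrightarrow> typed S \<Gamma> (Wrap M c) B"
| Blame: "typed S \<Gamma> (Blame A l) A"

inductive is_value :: "('c, 'a, 'x, 'm) pre_cast_struct_scheme \<Rightarrow> ('c, 'l) tm \<Rightarrow> bool"
  for S where
  Lam: "is_value S (Lam A M)"
| Const: "is_value S (Const k)"
| Tup: "is_value S V \<Longrightarrow> is_value S W \<Longrightarrow> is_value S (Tup V W)"
| InL: "is_value S V \<Longrightarrow> is_value S (InL B V)"
| InR: "is_value S V \<Longrightarrow> is_value S (InR A V)"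
| Wrap: "is_value S V \<Longrightarrow> Inert S c \<Longrightarrow> is_value S (Wrap V c)"

text \<open>
  The context is an argument of \<open>apply_cast\<close> because an intrinsically typed value determines its
  context, whereas a raw one does not.
\<close>

record ('c, 'a, 'x, 'l) cast_struct = "('c, 'a, 'x) pre_cast_struct" +
  apply_cast :: "ctx \<Rightarrow> ('c, 'l) tm \<Rightarrow> 'c \<Rightarrow> 'a \<Rightarrow> ('c, 'l) tm"

locale cast_struct = pre_cast_struct S
  for S :: "('c, 'a, 'x, 'l, 'm) cast_struct_scheme" +
  assumes apply_cast_typed: "is_value S V \<Longrightarrow> typed S \<Gamma> V A \<Longrightarrow> is_cast S c A B \<Longrightarrow> Active S c a \<Longrightarrow>
    typed S \<Gamma> (apply_cast S \<Gamma> V c a) B"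


section \<open>Reduction\<close>

datatype ('c, 'l) frame =
    FAppL "('c, 'l) tm"
  | FAppR "('c, 'l) tm"
  | FCond "('c, 'l) tm" "('c, 'l) tm"
  | FTupR "('c, 'l) tm"
  | FTupL "('c, 'l) tm"
  | FProj1
  | FProj2
  | FInL ty
  | FInR ty
  | FCase "('c, 'l) tm" "('c, 'l) tm"
  | FCast 'c
  | FWrap 'c

primrec plug :: "('c, 'l) frame \<Rightarrow> ('c, 'l) tm \<Rightarrow> ('c, 'l) tm" where
  "plug (FAppL M) L = App L M"
| "plug (FAppR V) M = App V M"
| "plug (FCond M N) L = Cond L M N"
| "plug (FTupR V) N = Tup V N"
| "plug (FTupL N) M = Tup M N"
| "plug FProj1 M = Proj1 M"
| "plug FProj2 M = Proj2 M"
| "plug (FInL B) M = InL B M"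
| "plug (FInR A) M = InR A M"
| "plug (FCase M N) L = Case L M N"
| "plug (FCast c) M = Cast M c"
| "plug (FWrap c) M = Wrap M c"

text \<open>
  \<open>typed_frame S \<Gamma> F A B\<close>: \<open>F\<close> is a frame that, around a term of type \<open>A\<close>, forms a term of type \<open>B\<close>.
\<close>

inductive typed_frame ::
  "('c, 'a, 'x, 'm) pre_cast_struct_scheme \<Rightarrow> ctx \<Rightarrow> ('c, 'l) frame \<Rightarrow> ty \<Rightarrow> ty \<Rightarrow> bool"
  for S where
  AppL: "typed S \<Gamma> M A \<Longrightarrow> typed_frame S \<Gamma> (FAppL M) (TFun A B) B"
| AppR: "is_value S V \<Longrightarrow> typed S \<Gamma> V (TFun A B) \<Longrightarrow> typed_frame S \<Gamma> (FAppR V) A B"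
| Cond: "typed S \<Gamma> M B \<Longrightarrow> typed S \<Gamma> N B \<Longrightarrow> typed_frame S \<Gamma> (FCond M N) (TBase BBool) B"
| TupR: "is_value S V \<Longrightarrow> typed S \<Gamma> V A \<Longrightarrow> typed_frame S \<Gamma> (FTupR V) B (TProd A B)"
| TupL: "typed S \<Gamma> N B \<Longrightarrow> typed_frame S \<Gamma> (FTupL N) A (TProd A B)"
| Proj1: "typed_frame S \<Gamma> FProj1 (TProd A B) A"
| Proj2: "typed_frame S \<Gamma> FProj2 (TProd A B) B"
| InL: "typed_frame S \<Gamma> (FInL B) A (TSum A B)"
| InR: "typed_frame S \<Gamma> (FInR A) B (TSum A B)"
| Case: "typed S (A1 # \<Gamma>) M B \<Longrightarrow> typed S (A2 # \<Gamma>) N B \<Longrightarrow>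
    typed_frame S \<Gamma> (FCase M N) (TSum A1 A2) B"
| Cast: "is_cast S c A B \<Longrightarrow> typed_frame S \<Gamma> (FCast c) A B"
| Wrap: "is_cast S c A B \<Longrightarrow> Inert S c \<Longrightarrow> typed_frame S \<Gamma> (FWrap c) A B"

text \<open>
  \<open>step S \<Gamma> A M M'\<close>: one reduction step between terms of type \<open>A\<close> in context \<open>\<Gamma>\<close>.
\<close>

inductive step ::
  "('c, 'a, 'x, 'l, 'm) cast_struct_scheme \<Rightarrow> ctx \<Rightarrow> ty \<Rightarrow> ('c, 'l) tm \<Rightarrow> ('c, 'l) tm \<Rightarrow> bool"
  for S where
  frame: "typed_frame S \<Gamma> F A B \<Longrightarrow> step S \<Gamma> A M M' \<Longrightarrow> step S \<Gamma> B (plug F M) (plug F M')"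
| frame_blame: "typed_frame S \<Gamma> F A B \<Longrightarrow> step S \<Gamma> B (plug F (Blame A l)) (Blame B l)"
| cast: "is_value S V \<Longrightarrow> typed S \<Gamma> (Cast V c) B \<Longrightarrow> Active S c a \<Longrightarrow>
    step S \<Gamma> B (Cast V c) (apply_cast S \<Gamma> V c a)"
| wrap: "is_value S V \<Longrightarrow> typed S \<Gamma> (Cast V c) B \<Longrightarrow> Inert S c \<Longrightarrow>
    step S \<Gamma> B (Cast V c) (Wrap V c)"
| app_wrap: "is_value S V \<Longrightarrow> is_value S W \<Longrightarrow> Inert S c \<Longrightarrow> Cross S c x \<Longrightarrow>
    typed S \<Gamma> (App (Wrap V c) W) B \<Longrightarrow>
    step S \<Gamma> B (App (Wrap V c) W) (Cast (App V (Cast W (dom_cast S c x))) (cod_cast S c x))"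
| proj1_wrap: "is_value S V \<Longrightarrow> Inert S c \<Longrightarrow> Cross S c x \<Longrightarrow> typed S \<Gamma> (Proj1 (Wrap V c)) B \<Longrightarrow>
    step S \<Gamma> B (Proj1 (Wrap V c)) (Cast (Proj1 V) (fst_cast S c x))"
| proj2_wrap: "is_value S V \<Longrightarrow> Inert S c \<Longrightarrow> Cross S c x \<Longrightarrow> typed S \<Gamma> (Proj2 (Wrap V c)) B \<Longrightarrow>
    step S \<Gamma> B (Proj2 (Wrap V c)) (Cast (Proj2 V) (snd_cast S c x))"
| case_wrap: "is_value S V \<Longrightarrow> Inert S c \<Longrightarrow> Cross S c x \<Longrightarrow> typed S \<Gamma> (Case (Wrap V c) M N) B \<Longrightarrow>
    step S \<Gamma> B (Case (Wrap V c) M N)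
      (Case V (cast_var0 (inl_cast S c x) M) (cast_var0 (inr_cast S c x) N))"
| beta: "is_value S V \<Longrightarrow> typed S \<Gamma> (App (Lam A M) V) B \<Longrightarrow>
    step S \<Gamma> B (App (Lam A M) V) (subst0 M V)"
| cond_true: "typed S \<Gamma> (Cond (Const (KBool True)) M N) B \<Longrightarrow>
    step S \<Gamma> B (Cond (Const (KBool True)) M N) M"
| cond_false: "typed S \<Gamma> (Cond (Const (KBool False)) M N) B \<Longrightarrow>
    step S \<Gamma> B (Cond (Const (KBool False)) M N) N"
| proj1_tup: "is_value S V \<Longrightarrow> is_value S W \<Longrightarrow> typed S \<Gamma> (Proj1 (Tup V W)) B \<Longrightarrow>
    step S \<Gamma> B (Proj1 (Tup V W)) V"
| proj2_tup: "is_value S V \<Longrightarrow> is_value S W \<Longrightarrow> typed S \<Gamma> (Proj2 (Tup V W)) B \<Longrightarrow>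
    step S \<Gamma> B (Proj2 (Tup V W)) W"
| case_inl: "is_value S V \<Longrightarrow> typed S \<Gamma> (Case (InL A V) M N) B \<Longrightarrow>
    step S \<Gamma> B (Case (InL A V) M N) (subst0 M V)"
| case_inr: "is_value S V \<Longrightarrow> typed S \<Gamma> (Case (InR A V) M N) B \<Longrightarrow>
    step S \<Gamma> B (Case (InR A V) M N) (subst0 N V)"
| delta: "k \<in> denote (PFun b P) \<Longrightarrow> k' \<in> denote (PBase b) \<Longrightarrow> const_app k k' = Some k'' \<Longrightarrow>
    step S \<Gamma> (prim_ty P) (App (Const k) (Const k')) (Const k'')"

abbreviation steps ::
  "('c, 'a, 'x, 'l, 'm) cast_struct_scheme \<Rightarrow> ctx \<Rightarrow> ty \<Rightarrow> ('c, 'l) tm \<Rightarrow> ('c, 'l) tm \<Rightarrow> bool" where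
  "steps S \<Gamma> A \<equiv> (step S \<Gamma> A)\<^sup>*\<^sup>*"


section \<open>Precision\<close>

record ('c, 'a, 'x, 'l) cast_struct_prec = "('c, 'a, 'x, 'l) cast_struct" +
  wrap_prec_wrap :: "'c \<Rightarrow> 'c \<Rightarrow> bool"
  wrap_prec_ty :: "'c \<Rightarrow> ty \<Rightarrow> bool"
  ty_prec_wrap :: "ty \<Rightarrow> 'c \<Rightarrow> bool"

locale pre_cast_struct_with_precision = pre_cast_struct S
  for S :: "('c, 'a, 'x, 'l, 'm) cast_struct_prec_scheme" +
  assumes wrap_prec_ty_intro: "Inert S i \<Longrightarrow> is_cast S i A B \<Longrightarrow> A \<sqsubseteq> C' \<Longrightarrow> B \<sqsubseteq> C' \<Longrightarrow>
          wrap_prec_ty S i C'"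
    and wrap_prec_wrap_elim: "Inert S i \<Longrightarrow> is_cast S i A B \<Longrightarrow> Inert S i' \<Longrightarrow> is_cast S i' A' B' \<Longrightarrow>
          wrap_prec_wrap S i i' \<Longrightarrow> A \<sqsubseteq> A' \<and> B \<sqsubseteq> B'"
    and wrap_prec_ty_elim: "Inert S i \<Longrightarrow> is_cast S i A B \<Longrightarrow> wrap_prec_ty S i C' \<Longrightarrow>
          A \<sqsubseteq> C' \<and> B \<sqsubseteq> C'"
    and ty_prec_wrap_elim: "Inert S i' \<Longrightarrow> is_cast S i' A' B' \<Longrightarrow> ty_prec_wrap S C i' \<Longrightarrow>
          C \<sqsubseteq> A' \<and> C \<sqsubseteq> B'"

text \<open>
  \<open>prec S \<Gamma> \<Gamma>' M A M' A'\<close>: the term \<open>M\<close> of type \<open>A\<close> in context \<open>\<Gamma>\<close> is less precise than the term \<open>M'\<close>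
  of type \<open>A'\<close> in context \<open>\<Gamma>'\<close>.  Both typings are implied (\<open>prec_typed\<close> below).
\<close>

inductive prec ::
  "('c, 'a, 'x, 'l, 'm) cast_struct_prec_scheme \<Rightarrow>
   ctx \<Rightarrow> ctx \<Rightarrow> ('c, 'l) tm \<Rightarrow> ty \<Rightarrow> ('c, 'l) tm \<Rightarrow> ty \<Rightarrow> bool"
  for S where
  Const: "k \<in> denote P \<Longrightarrow> prec S \<Gamma> \<Gamma>' (Const k) (prim_ty P) (Const k) (prim_ty P)"
| Var: "x < length \<Gamma> \<Longrightarrow> \<Gamma> ! x = A \<Longrightarrow> x < length \<Gamma>' \<Longrightarrow> \<Gamma>' ! x = A' \<Longrightarrow>
    prec S \<Gamma> \<Gamma>' (Var x) A (Var x) A'"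
| Lam: "prec S (A # \<Gamma>) (A' # \<Gamma>') N B N' B' \<Longrightarrow> A \<sqsubseteq> A' \<Longrightarrow>
    prec S \<Gamma> \<Gamma>' (Lam A N) (TFun A B) (Lam A' N') (TFun A' B')"
| App: "prec S \<Gamma> \<Gamma>' L (TFun A B) L' (TFun A' B') \<Longrightarrow> prec S \<Gamma> \<Gamma>' M A M' A' \<Longrightarrow>
    prec S \<Gamma> \<Gamma>' (App L M) B (App L' M') B'"
| Cond: "prec S \<Gamma> \<Gamma>' L (TBase BBool) L' (TBase BBool) \<Longrightarrow> prec S \<Gamma> \<Gamma>' M B M' B' \<Longrightarrow>
    prec S \<Gamma> \<Gamma>' N B N' B' \<Longrightarrow> prec S \<Gamma> \<Gamma>' (Cond L M N) B (Cond L' M' N') B'"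
| Tup: "prec S \<Gamma> \<Gamma>' M A M' A' \<Longrightarrow> prec S \<Gamma> \<Gamma>' N B N' B' \<Longrightarrow>
    prec S \<Gamma> \<Gamma>' (Tup M N) (TProd A B) (Tup M' N') (TProd A' B')"
| Proj1: "prec S \<Gamma> \<Gamma>' M (TProd A B) M' (TProd A' B') \<Longrightarrow> prec S \<Gamma> \<Gamma>' (Proj1 M) A (Proj1 M') A'"
| Proj2: "prec S \<Gamma> \<Gamma>' M (TProd A B) M' (TProd A' B') \<Longrightarrow> prec S \<Gamma> \<Gamma>' (Proj2 M) B (Proj2 M') B'"
| InL: "prec S \<Gamma> \<Gamma>' M A M' A' \<Longrightarrow> B \<sqsubseteq> B' \<Longrightarrow>
    prec S \<Gamma> \<Gamma>' (InL B M) (TSum A B) (InL B' M') (TSum A' B')"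
| InR: "prec S \<Gamma> \<Gamma>' M B M' B' \<Longrightarrow> A \<sqsubseteq> A' \<Longrightarrow>
    prec S \<Gamma> \<Gamma>' (InR A M) (TSum A B) (InR A' M') (TSum A' B')"
| Case: "prec S \<Gamma> \<Gamma>' L (TSum A1 A2) L' (TSum A1' A2') \<Longrightarrow> A1 \<sqsubseteq> A1' \<Longrightarrow> A2 \<sqsubseteq> A2' \<Longrightarrow>
    prec S (A1 # \<Gamma>) (A1' # \<Gamma>') M B M' B' \<Longrightarrow> prec S (A2 # \<Gamma>) (A2' # \<Gamma>') N B N' B' \<Longrightarrow>
    prec S \<Gamma> \<Gamma>' (Case L M N) B (Case L' M' N') B'"
| Cast: "prec S \<Gamma> \<Gamma>' M A M' A' \<Longrightarrow> is_cast S c A B \<Longrightarrow> is_cast S c' A' B' \<Longrightarrow> A \<sqsubseteq> A' \<Longrightarrow> B \<sqsubseteq> B' \<Longrightarrow>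
    prec S \<Gamma> \<Gamma>' (Cast M c) B (Cast M' c') B'"
| CastL: "prec S \<Gamma> \<Gamma>' M A M' A' \<Longrightarrow> is_cast S c A B \<Longrightarrow> A \<sqsubseteq> A' \<Longrightarrow> B \<sqsubseteq> A' \<Longrightarrow>
    prec S \<Gamma> \<Gamma>' (Cast M c) B M' A'"
| CastR: "prec S \<Gamma> \<Gamma>' M A M' A' \<Longrightarrow> is_cast S c' A' B' \<Longrightarrow> A \<sqsubseteq> A' \<Longrightarrow> A \<sqsubseteq> B' \<Longrightarrow>
    prec S \<Gamma> \<Gamma>' M A (Cast M' c') B'"
| Wrap: "prec S \<Gamma> \<Gamma>' M A M' A' \<Longrightarrow> Inert S i \<Longrightarrow> Inert S i' \<Longrightarrow> wrap_prec_wrap S i i' \<Longrightarrow>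
    is_cast S i A B \<Longrightarrow> is_cast S i' A' B' \<Longrightarrow> (B = Dyn \<longrightarrow> B' = Dyn) \<Longrightarrow>
    prec S \<Gamma> \<Gamma>' (Wrap M i) B (Wrap M' i') B'"
| WrapL: "prec S \<Gamma> \<Gamma>' M A M' A' \<Longrightarrow> Inert S i \<Longrightarrow> is_cast S i A B \<Longrightarrow> wrap_prec_ty S i A' \<Longrightarrow>
    prec S \<Gamma> \<Gamma>' (Wrap M i) B M' A'"
| WrapR: "prec S \<Gamma> \<Gamma>' M A M' A' \<Longrightarrow> Inert S i' \<Longrightarrow> is_cast S i' A' B' \<Longrightarrow> A \<noteq> Dyn \<Longrightarrow>
    ty_prec_wrap S A i' \<Longrightarrow> prec S \<Gamma> \<Gamma>' M A (Wrap M' i') B'"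
| Blame: "typed S \<Gamma> M A \<Longrightarrow> A \<sqsubseteq> A' \<Longrightarrow> prec S \<Gamma> \<Gamma>' M A (Blame A' l) A'"

text \<open>
  \<open>prec_values S \<Gamma> \<Gamma>' V A V' A'\<close> collects the hypotheses common to the five conditions below.
\<close>

definition prec_values ::
  "('c, 'a, 'x, 'l, 'm) cast_struct_prec_scheme \<Rightarrow>
   ctx \<Rightarrow> ctx \<Rightarrow> ('c, 'l) tm \<Rightarrow> ty \<Rightarrow> ('c, 'l) tm \<Rightarrow> ty \<Rightarrow> bool" where
  "prec_values S \<Gamma> \<Gamma>' V A V' A' \<longleftrightarrow>
     is_value S V \<and> typed S \<Gamma> V A \<and> is_value S V' \<and> typed S \<Gamma>' V' A' \<and>
     prec S \<Gamma> \<Gamma>' V A V' A' \<and> A \<sqsubseteq> A'"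

locale cast_struct_with_precision = cast_struct S + pre_cast_struct_with_precision S
  for S :: "('c, 'a, 'x, 'l, 'm) cast_struct_prec_scheme" +
  assumes apply_cast_left:
      "prec_values S \<Gamma> \<Gamma>' V A V' A' \<Longrightarrow> is_cast S c A B \<Longrightarrow> Active S c a \<Longrightarrow> B \<sqsubseteq> A' \<Longrightarrow>
       \<exists>W. is_value S W \<and> steps S \<Gamma> B (apply_cast S \<Gamma> V c a) W \<and> prec S \<Gamma> \<Gamma>' W B V' A'"
    and cast_apply_cast:
      "prec_values S [] [] V A V' A' \<Longrightarrow> is_cast S c A B \<Longrightarrow> is_cast S c' A' B' \<Longrightarrow>
       Active S c' a' \<Longrightarrow> B \<sqsubseteq> B' \<Longrightarrow>
       \<exists>N. steps S [] B (Cast V c) N \<and> prec S [] [] N B (apply_cast S [] V' c' a') B'"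
    and cast_wrap:
      "prec_values S [] [] V A V' A' \<Longrightarrow> is_cast S c A B \<Longrightarrow> is_cast S c' A' B' \<Longrightarrow>
       Inert S c' \<Longrightarrow> B \<sqsubseteq> B' \<Longrightarrow>
       \<exists>N. steps S [] B (Cast V c) N \<and> prec S [] [] N B (Wrap V' c') B'"
    and apply_cast_right:
      "prec_values S [] [] V A V' A' \<Longrightarrow> is_cast S c' A' B' \<Longrightarrow> Active S c' a' \<Longrightarrow> A \<sqsubseteq> B' \<Longrightarrow>
       prec S [] [] V A (apply_cast S [] V' c' a') B'"
    and wrap_right:
      "prec_values S [] [] V A V' A' \<Longrightarrow> is_cast S c' A' B' \<Longrightarrow> Inert S c' \<Longrightarrow> A \<sqsubseteq> B' \<Longrightarrow>
       prec S [] [] V A (Wrap V' c') B'"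


section \<open>Coherence of the typing annotations\<close>

lemma denote_base_unique: "k \<in> denote_base b \<Longrightarrow> k \<in> denote_base b' \<Longrightarrow> b = b'"
  by (cases b; cases b') auto

lemma denote_unique: "k \<in> denote P \<Longrightarrow> k \<in> denote Q \<Longrightarrow> P = Q"
proof (induction P arbitrary: k Q)
  case (PBase b)
  show ?case
  proof (cases Q)
    case (PBase b')
    with PBase.prems show ?thesis by (auto dest: denote_base_unique)
  next
    case (PFun b' Q')
    with PBase.prems show ?thesis by (cases b; cases b') auto
  qed
next
  case (PFun b P)
  show ?case
  proof (cases Q)
    case (PBase b')
    with PFun.prems show ?thesis by (cases b; cases b') auto
  next
    case Q: (PFun b' Q')
    with PFun.prems PFun.IH show ?thesis by (cases b; cases b') auto
  qed
qed

inductive_simps typed_simps: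
  "typed S \<Gamma> (Const k) A" "typed S \<Gamma> (Var x) A" "typed S \<Gamma> (Lam B M) A" "typed S \<Gamma> (App L M) A"
  "typed S \<Gamma> (Cond L M N) A" "typed S \<Gamma> (Tup M N) A" "typed S \<Gamma> (Proj1 M) A" "typed S \<Gamma> (Proj2 M) A"
  "typed S \<Gamma> (InL B M) A" "typed S \<Gamma> (InR B M) A" "typed S \<Gamma> (Case L M N) A" "typed S \<Gamma> (Cast M c) A"
  "typed S \<Gamma> (Wrap M c) A" "typed S \<Gamma> (Blame B l) A"

lemma typed_unique: "typed S \<Gamma> M A \<Longrightarrow> typed S \<Gamma> M B \<Longrightarrow> A = B"
proof (induction arbitrary: B rule: typed.induct)
  case (Const k P \<Gamma>)
  from Const.prems obtain Q where "B = prim_ty Q" "k \<in> denote Q" by (auto simp: typed_simps)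
  with Const.hyps denote_unique show ?case by blast
next
  case (Var x \<Gamma> A)
  from Var.prems Var.hyps show ?case by (simp add: typed_simps)
next
  case (Lam A \<Gamma> M C)
  from Lam.prems obtain D where "B = TFun A D" "typed S (A # \<Gamma>) M D" by (auto simp: typed_simps)
  with Lam.IH[of D] show ?case by simp
next
  case (App \<Gamma> L A C M)
  from App.prems obtain A' where "typed S \<Gamma> L (TFun A' B)" by (auto simp: typed_simps)
  from App.IH(1)[OF this] show ?case by simp
next
  case (Cond \<Gamma> L M C N)
  from Cond.prems have "typed S \<Gamma> M B" by (simp add: typed_simps)
  from Cond.IH(2)[OF this] show ?case .
next
  case (Tup \<Gamma> M A N C)
  from Tup.prems obtain A' C' where "B = TProd A' C'" "typed S \<Gamma> M A'" "typed S \<Gamma> N C'"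
    by (auto simp: typed_simps)
  with Tup.IH(1)[of A'] Tup.IH(2)[of C'] show ?case by simp
next
  case (Proj1 \<Gamma> M A C)
  from Proj1.prems obtain C' where "typed S \<Gamma> M (TProd B C')" by (auto simp: typed_simps)
  from Proj1.IH[OF this] show ?case by simp
next
  case (Proj2 \<Gamma> M A C)
  from Proj2.prems obtain A' where "typed S \<Gamma> M (TProd A' B)" by (auto simp: typed_simps)
  from Proj2.IH[OF this] show ?case by simp
next
  case (InL \<Gamma> M A C)
  from InL.prems obtain A' where "B = TSum A' C" "typed S \<Gamma> M A'" by (auto simp: typed_simps)
  with InL.IH[of A'] show ?case by simp
next
  case (InR \<Gamma> M C A)
  from InR.prems obtain C' where "B = TSum A C'" "typed S \<Gamma> M C'" by (auto simp: typed_simps)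
  with InR.IH[of C'] show ?case by simp
next
  case (Case \<Gamma> L A1 A2 M C N)
  from Case.prems obtain B1 B2 where L: "typed S \<Gamma> L (TSum B1 B2)" and M: "typed S (B1 # \<Gamma>) M B"
    by (auto simp: typed_simps)
  from Case.IH(1)[OF L] M have "typed S (A1 # \<Gamma>) M B" by simp
  from Case.IH(2)[OF this] show ?case .
next
  case (Cast \<Gamma> M A c C)
  from Cast.prems Cast.hyps show ?case by (auto simp: typed_simps is_cast_def)
next
  case (Wrap \<Gamma> M A c C)
  from Wrap.prems Wrap.hyps show ?case by (auto simp: typed_simps is_cast_def)
next
  case (Blame \<Gamma> A l)
  from Blame.prems show ?case by (simp add: typed_simps)
qed

lemma prec_typed: "prec S \<Gamma> \<Gamma>' M A M' A' \<Longrightarrow> typed S \<Gamma> M A \<and> typed S \<Gamma>' M' A'"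
  by (induction rule: prec.induct) (simp_all add: typed_simps, blast+)

lemma typed_frame_plug: "typed_frame S \<Gamma> F A B \<Longrightarrow> typed S \<Gamma> M A \<Longrightarrow> typed S \<Gamma> (plug F M) B"
  by (induction rule: typed_frame.induct) (simp_all add: typed_simps, blast+)

lemma typed_rename:
  "typed S \<Gamma> M A \<Longrightarrow> (\<And>x. x < length \<Gamma> \<Longrightarrow> \<rho> x < length \<Delta> \<and> \<Delta> ! \<rho> x = \<Gamma> ! x) \<Longrightarrow>
   typed S \<Delta> (rename \<rho> M) A"
proof (induction arbitrary: \<rho> \<Delta> rule: typed.induct)
  case (Lam A \<Gamma> M B)
  have "typed S (A # \<Delta>) (rename (ext \<rho>) M) B"
    by (rule Lam.IH) (use Lam.prems in \<open>case_tac x; auto\<close>)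
  then show ?case by (simp add: typed_simps)
next
  case (Case \<Gamma> L A1 A2 M B N)
  have "typed S (A1 # \<Delta>) (rename (ext \<rho>) M) B"
    by (rule Case.IH(2)) (use Case.prems in \<open>case_tac x; auto\<close>)
  moreover have "typed S (A2 # \<Delta>) (rename (ext \<rho>) N) B"
    by (rule Case.IH(3)) (use Case.prems in \<open>case_tac x; auto\<close>)
  moreover have "typed S \<Delta> (rename \<rho> L) (TSum A1 A2)"
    by (rule Case.IH(1)) (rule Case.prems)
  ultimately show ?case by (auto simp: typed_simps)
qed (simp_all add: typed_simps, blast+)

lemma typed_exts:
  assumes "\<And>x. x < length \<Gamma> \<Longrightarrow> typed S \<Delta> (\<sigma> x) (\<Gamma> ! x)" and "x < length (A # \<Gamma>)"
  shows "typed S (A # \<Delta>) (exts \<sigma> x) ((A # \<Gamma>) ! x)"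
proof (cases x)
  case 0
  then show ?thesis by (auto intro: typed.intros)
next
  case (Suc n)
  with assms have "typed S \<Delta> (\<sigma> n) (\<Gamma> ! n)" by auto
  then have "typed S (A # \<Delta>) (rename Suc (\<sigma> n)) (\<Gamma> ! n)" by (rule typed_rename) auto
  with Suc show ?thesis by simp
qed

lemma typed_subst:
  "typed S \<Gamma> M A \<Longrightarrow> (\<And>x. x < length \<Gamma> \<Longrightarrow> typed S \<Delta> (\<sigma> x) (\<Gamma> ! x)) \<Longrightarrow>
   typed S \<Delta> (subst \<sigma> M) A"
proof (induction arbitrary: \<sigma> \<Delta> rule: typed.induct)
  case (Lam A \<Gamma> M B)
  have "typed S (A # \<Delta>) (subst (exts \<sigma>) M) B"
    by (rule Lam.IH) (rule typed_exts[OF Lam.prems])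
  then show ?case by (simp add: typed_simps)
next
  case (Case \<Gamma> L A1 A2 M B N)
  have "typed S (A1 # \<Delta>) (subst (exts \<sigma>) M) B"
    by (rule Case.IH(2)) (rule typed_exts[OF Case.prems])
  moreover have "typed S (A2 # \<Delta>) (subst (exts \<sigma>) N) B"
    by (rule Case.IH(3)) (rule typed_exts[OF Case.prems])
  moreover have "typed S \<Delta> (subst \<sigma> L) (TSum A1 A2)"
    by (rule Case.IH(1)) (rule Case.prems)
  ultimately show ?case by (auto simp: typed_simps)
qed (simp_all add: typed_simps, blast+)

lemma typed_subst0:
  assumes "typed S (A # \<Gamma>) M B" and "typed S \<Gamma> N A"
  shows "typed S \<Gamma> (subst0 M N) B"
  unfolding subst0_def
  by (rule typed_subst[OF assms(1)]) (use assms(2) in \<open>auto split: nat.splits intro: typed.intros\<close>)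

lemma typed_cast_var0:
  assumes "typed S (B # \<Gamma>) M C" and "is_cast S c A B"
  shows "typed S (A # \<Gamma>) (cast_var0 c M) C"
  unfolding cast_var0_def
  by (rule typed_subst[OF assms(1)])
    (use assms(2) in \<open>auto simp: nth_Cons split: nat.splits intro!: typed.intros\<close>)

lemma const_app_denote:
  assumes "k \<in> denote (PFun b P)" and "k' \<in> denote (PBase b)"
  shows "\<exists>k''. const_app k k' = Some k'' \<and> k'' \<in> denote P"
  using assms by (cases b) auto

lemma (in cast_struct) step_typed: "step S \<Gamma> A M M' \<Longrightarrow> typed S \<Gamma> M A \<and> typed S \<Gamma> M' A"
proof (induction rule: step.induct)
  case (app_wrap V W c x \<Gamma> B)
  then obtain A A' where *: "typed S \<Gamma> V A'" "is_cast S c A' (TFun A B)" "typed S \<Gamma> W A"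
    by (auto simp: typed_simps)
  with inert_fun app_wrap.hyps obtain A1 A2 where "A' = TFun A1 A2" by blast
  with * app_wrap.hyps show ?case by (simp add: typed_simps) (blast intro: dom_cast cod_cast)
next
  case (proj1_wrap V c x \<Gamma> B)
  then obtain C A' where *: "typed S \<Gamma> V A'" "is_cast S c A' (TProd B C)"
    by (auto simp: typed_simps)
  with inert_prod proj1_wrap.hyps obtain A1 A2 where "A' = TProd A1 A2" by blast
  with * proj1_wrap.hyps show ?case by (simp add: typed_simps) (blast intro: fst_cast)
next
  case (proj2_wrap V c x \<Gamma> B)
  then obtain C A' where *: "typed S \<Gamma> V A'" "is_cast S c A' (TProd C B)"
    by (auto simp: typed_simps)
  with inert_prod proj2_wrap.hyps obtain A1 A2 where "A' = TProd A1 A2" by blast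
  with * proj2_wrap.hyps show ?case by (simp add: typed_simps) (blast intro: snd_cast)
next
  case (case_wrap V c x \<Gamma> M N B)
  then obtain B1 B2 A' where *: "typed S \<Gamma> V A'" "is_cast S c A' (TSum B1 B2)"
      "typed S (B1 # \<Gamma>) M B" "typed S (B2 # \<Gamma>) N B"
    by (auto simp: typed_simps)
  with inert_sum case_wrap.hyps obtain A1 A2 where "A' = TSum A1 A2" by blast
  with * case_wrap.hyps show ?case by (simp add: typed_simps) (blast intro: typed_cast_var0 inl_cast inr_cast)
next
  case (delta k b P k' k'' \<Gamma>)
  have "typed S \<Gamma> (Const k) (prim_ty (PFun b P))" "typed S \<Gamma> (Const k') (prim_ty (PBase b))"
    using delta.hyps by (blast intro: typed.Const)+
  moreover have "k'' \<in> denote P"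
    using const_app_denote[OF delta.hyps(1,2)] delta.hyps(3) by auto
  ultimately show ?case by (auto intro: typed.App typed.Const)
next
  case (frame \<Gamma> F A B M M')
  then show ?case by (blast intro: typed_frame_plug)
next
  case (frame_blame \<Gamma> F A B l)
  then show ?case by (blast intro: typed_frame_plug typed.Blame)
next
  case (cast V \<Gamma> c B a)
  then show ?case by (auto simp: typed_simps(12) intro: apply_cast_typed)
next
  case (wrap V \<Gamma> c B)
  then show ?case by (auto simp: typed_simps(12,13))
next
  case (beta V \<Gamma> A M B)
  then show ?case by (auto simp: typed_simps intro: typed_subst0)
next
  case (case_inl V \<Gamma> A M N B)
  then show ?case by (auto simp: typed_simps intro: typed_subst0)
next
  case (case_inr V \<Gamma> A M N B)
  then show ?case by (auto simp: typed_simps intro: typed_subst0)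
qed (auto simp: typed_simps)

end

theory Submission
  imports Defs
begin

text \<open>
  The proof is by induction on term precision, inverting the reduction step of the more precise
  term.  A term below a value reduces to a value that is still below it, so the less precise
  side can always be brought to a redex.  An elimination form applied to a value that carries
  wrappers absent from the more precise value pushes these wrappers outwards one at a time, which
  the left-hand cast rule of term precision absorbs.
\<close>

\<comment> \<open>Precision is not syntax-directed: casts and wrappers may occur on one side only,
  and this decides how many steps the less precise side takes. When an elimination form meets a
  value, a wrapper on both sides is opened in lockstep, one on the right alone is answered by
  standing still, and one on the left alone must be opened before the right-hand redex can be
  matched. Only the last situation leaves the right-hand step as it was, so only there does the
  argument recurse. Active casts are opaque: \<open>apply_cast\<close> may return any term of the
  right type, so nothing can be proved about it by inspection, and the five conditions of the
  structure enter exactly where a cast meets a value. Four of them speak of closed values only,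
  which keeps the simulation in the empty context; open terms matter only through substitution into
  binders. Since \<open>step\<close> carries a type, inverting a step under a frame yields a type
  unrelated on its face to the one in the precision derivation; uniqueness of typing or the
  endpoints of the cast reconcile the two.\<close>
inductive_simps ty_prec_simps:
  "TFun A B \<sqsubseteq> TFun A' B'" "TProd A B \<sqsubseteq> TProd A' B'" "TSum A B \<sqsubseteq> TSum A' B'"

lemma ty_prec_refl: "A \<sqsubseteq> A"
  by (induction A) (auto intro: ty_prec.intros)

inductive_simps is_value_simps:
  "is_value S (Const k)" "is_value S (Var x)" "is_value S (Lam B M)" "is_value S (App L M)"
  "is_value S (Cond L M N)" "is_value S (Tup M N)" "is_value S (Proj1 M)" "is_value S (Proj2 M)"
  "is_value S (InL B M)" "is_value S (InR B M)" "is_value S (Case L M N)" "is_value S (Cast M c)"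
  "is_value S (Wrap M c)" "is_value S (Blame B l)"

inductive_simps typed_frame_simps:
  "typed_frame S \<Gamma> (FAppL M) A B" "typed_frame S \<Gamma> (FAppR M) A B" "typed_frame S \<Gamma> (FCond M N) A B"
  "typed_frame S \<Gamma> (FTupL M) A B" "typed_frame S \<Gamma> (FTupR M) A B" "typed_frame S \<Gamma> FProj1 A B"
  "typed_frame S \<Gamma> FProj2 A B" "typed_frame S \<Gamma> (FInL C) A B" "typed_frame S \<Gamma> (FInR C) A B"
  "typed_frame S \<Gamma> (FCase M N) A B" "typed_frame S \<Gamma> (FCast c) A B" "typed_frame S \<Gamma> (FWrap c) A B"


section \<open>Reduction\<close>

text \<open>Frames for pairs, injections and wrappers can build values, so a term with a step under
  a frame is not excluded from being a value by its outermost constructor; the value property has to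
  be passed down to the hole.\<close>

lemma is_value_plugD: "is_value S (plug F M) \<Longrightarrow> is_value S M"
  by (cases F) (simp_all add: is_value_simps)

lemma step_not_value: "step S \<Gamma> A M N \<Longrightarrow> \<not> is_value S M"
  by (induction rule: step.induct) (auto simp: is_value_simps dest: is_value_plugD)

lemma steps_plug:
  "steps S \<Gamma> A M N \<Longrightarrow> typed_frame S \<Gamma> F A B \<Longrightarrow> steps S \<Gamma> B (plug F M) (plug F N)"
  by (induction rule: rtranclp_induct) (auto intro: step.frame rtranclp.rtrancl_into_rtrancl)

text \<open>Instances with \<open>plug\<close> evaluated: unification cannot recover a frame from a
  concrete term constructor.\<close>

lemmas steps_frame = steps_plug[where F = "FAppL M" for M, simplified]
  steps_plug[where F = "FAppR M" for M, simplified]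
  steps_plug[where F = "FCond M N" for M N, simplified]
  steps_plug[where F = "FTupL M" for M, simplified]
  steps_plug[where F = "FTupR M" for M, simplified]
  steps_plug[where F = FProj1, simplified]
  steps_plug[where F = FProj2, simplified]
  steps_plug[where F = "FInL C" for C, simplified]
  steps_plug[where F = "FInR C" for C, simplified]
  steps_plug[where F = "FCase M N" for M N, simplified]
  steps_plug[where F = "FCast c" for c, simplified]
  steps_plug[where F = "FWrap c" for c, simplified]

text \<open>All redexes are merged into \<open>head\<close>, which keeps only that both parts are
  values. This is what the less precise side needs in order to catch up; the redex itself is
  analysed afterwards by \<open>step_App_valuesE\<close>. The origin of a blame is dropped because
  the result alone determines the answer.\<close>

lemma step_AppE:
  assumes "step S \<Gamma> B (App L M) N"
  obtains (fn) A L2 where "typed S \<Gamma> M A" "step S \<Gamma> (TFun A B) L L2" "N = App L2 M"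
  | (arg) A M2 where "is_value S L" "typed S \<Gamma> L (TFun A B)" "step S \<Gamma> A M M2" "N = App L M2"
  | (blame) l where "N = Blame B l"
  | (head) "is_value S L" "is_value S M"
  using assms
proof cases
  case (frame F A M M')
  then show ?thesis by (cases F) (auto simp: typed_frame_simps intro: that)
next
  case (frame_blame F A l)
  then show ?thesis by (auto intro: that)
qed (auto simp: is_value_simps intro: that)

lemma step_CondE:
  assumes "step S \<Gamma> B (Cond L M N) R"
  obtains (frame) L2 where "step S \<Gamma> (TBase BBool) L L2" "R = Cond L2 M N"
  | (blame) l where "R = Blame B l"
  | (true) "L = Const (KBool True)" "R = M"
  | (false) "L = Const (KBool False)" "R = N"
  using assms
proof cases
  case (frame F A M M')
  then show ?thesis by (cases F) (auto simp: typed_frame_simps intro: that)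
qed (auto intro: that)

lemma step_TupE:
  assumes "step S \<Gamma> T (Tup M N) R"
  obtains (left) A B M2 where "T = TProd A B" "step S \<Gamma> A M M2" "R = Tup M2 N"
  | (right) A B N2 where "T = TProd A B" "is_value S M" "step S \<Gamma> B N N2" "R = Tup M N2"
  | (blame) l where "R = Blame T l"
  using assms
proof cases
  case (frame F A M M')
  then show ?thesis by (cases F) (auto simp: typed_frame_simps intro: that)
qed (auto intro: that)

lemma step_Proj1E:
  assumes "step S \<Gamma> A (Proj1 M) R"
  obtains (frame) B M2 where "step S \<Gamma> (TProd A B) M M2" "R = Proj1 M2"
  | (blame) l where "R = Blame A l"
  | (head) "is_value S M"
  using assms
proof cases
  case (frame F A M M')
  then show ?thesis by (cases F) (auto simp: typed_frame_simps intro: that)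
qed (auto simp: is_value_simps intro: that)

lemma step_Proj2E:
  assumes "step S \<Gamma> B (Proj2 M) R"
  obtains (frame) A M2 where "step S \<Gamma> (TProd A B) M M2" "R = Proj2 M2"
  | (blame) l where "R = Blame B l"
  | (head) "is_value S M"
  using assms
proof cases
  case (frame F A M M')
  then show ?thesis by (cases F) (auto simp: typed_frame_simps intro: that)
qed (auto simp: is_value_simps intro: that)

lemma step_InLE:
  assumes "step S \<Gamma> T (InL B M) R"
  obtains (frame) A M2 where "T = TSum A B" "step S \<Gamma> A M M2" "R = InL B M2"
  | (blame) l where "R = Blame T l"
  using assms
proof cases
  case (frame F A M M')
  then show ?thesis by (cases F) (auto simp: typed_frame_simps intro: that)
qed (auto intro: that)

lemma step_InRE:
  assumes "step S \<Gamma> T (InR A M) R"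
  obtains (frame) B M2 where "T = TSum A B" "step S \<Gamma> B M M2" "R = InR A M2"
  | (blame) l where "R = Blame T l"
  using assms
proof cases
  case (frame F A M M')
  then show ?thesis by (cases F) (auto simp: typed_frame_simps intro: that)
qed (auto intro: that)

lemma step_CaseE:
  assumes "step S \<Gamma> B (Case L M N) R"
  obtains (frame) A1 A2 L2 where "step S \<Gamma> (TSum A1 A2) L L2" "R = Case L2 M N"
  | (blame) l where "R = Blame B l"
  | (head) "is_value S L"
  using assms
proof cases
  case (frame F A M M')
  then show ?thesis by (cases F) (auto simp: typed_frame_simps intro: that)
qed (auto simp: is_value_simps intro: that)

lemma step_CastE:
  assumes "step S \<Gamma> B (Cast M c) R"
  obtains (frame) A M2 where "is_cast S c A B" "step S \<Gamma> A M M2" "R = Cast M2 c"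
  | (blame) l where "R = Blame B l"
  | (cast) a where "is_value S M" "Active S c a" "R = apply_cast S \<Gamma> M c a"
  | (wrap) "is_value S M" "Inert S c" "R = Wrap M c"
  using assms
proof cases
  case (frame F A M M')
  then show ?thesis by (cases F) (auto simp: typed_frame_simps intro: that)
qed (auto intro: that)

lemma step_WrapE:
  assumes "step S \<Gamma> B (Wrap M c) R"
  obtains (frame) A M2 where "is_cast S c A B" "step S \<Gamma> A M M2" "R = Wrap M2 c"
  | (blame) l where "R = Blame B l"
  using assms
proof cases
  case (frame F A M M')
  then show ?thesis by (cases F) (auto simp: typed_frame_simps intro: that)
qed (auto intro: that)

lemma plug_neq_leaf:
  "plug F M \<noteq> Const k" "plug F M \<noteq> Var x" "plug F M \<noteq> Lam A N" "plug F M \<noteq> Blame A l"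
  by (cases F; simp)+

text \<open>No frame produces such a term and no redex has this form. This disposes of the precision
  rules whose right-hand term is a leaf.\<close>

lemma no_step_leaf:
  "\<not> step S \<Gamma> A (Const k) R" "\<not> step S \<Gamma> A (Var x) R" "\<not> step S \<Gamma> A (Lam B M) R"
  "\<not> step S \<Gamma> A (Blame B l) R"
  by (rule notI, erule step.cases; simp add: plug_neq_leaf[symmetric])+

text \<open>The frame rules drop out: a value does not step and a blame is not a value. The
  primitive types are kept in \<open>delta\<close> because the less precise side has to repeat that
  step at the same types.\<close>

lemma step_App_valuesE:
  assumes "step S \<Gamma> B (App L M) N" "is_value S L" "is_value S M"
  obtains (wrap) V c x where "L = Wrap V c" "Inert S c" "Cross S c x"
      "N = Cast (App V (Cast M (dom_cast S c x))) (cod_cast S c x)"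
  | (beta) A M0 where "L = Lam A M0" "N = subst0 M0 M"
  | (delta) k b P k' k'' where "L = Const k" "M = Const k'" "k \<in> denote (PFun b P)"
      "k' \<in> denote (PBase b)" "const_app k k' = Some k''" "N = Const k''" "B = prim_ty P"
  using assms(1)
proof cases
  case (frame F A M M')
  with assms show ?thesis by (cases F) (auto dest: step_not_value)
next
  case (frame_blame F A l)
  with assms show ?thesis by (cases F) (auto simp: is_value_simps)
qed (auto intro: that)

lemma step_Proj1_valueE:
  assumes "step S \<Gamma> B (Proj1 M) N" "is_value S M"
  obtains (wrap) V c x where "M = Wrap V c" "Inert S c" "Cross S c x"
      "N = Cast (Proj1 V) (fst_cast S c x)"
  | (tup) W where "M = Tup N W"
  using assms(1)
proof cases
  case (frame F A M M')
  with assms show ?thesis by (cases F) (auto dest: step_not_value)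
next
  case (frame_blame F A l)
  with assms show ?thesis by (cases F) (auto simp: is_value_simps)
qed (auto intro: that)

lemma step_Proj2_valueE:
  assumes "step S \<Gamma> B (Proj2 M) N" "is_value S M"
  obtains (wrap) V c x where "M = Wrap V c" "Inert S c" "Cross S c x"
      "N = Cast (Proj2 V) (snd_cast S c x)"
  | (tup) V where "M = Tup V N"
  using assms(1)
proof cases
  case (frame F A M M')
  with assms show ?thesis by (cases F) (auto dest: step_not_value)
next
  case (frame_blame F A l)
  with assms show ?thesis by (cases F) (auto simp: is_value_simps)
qed (auto intro: that)

lemma step_Case_valueE:
  assumes "step S \<Gamma> B (Case L M N) R" "is_value S L"
  obtains (wrap) V c x where "L = Wrap V c" "Inert S c" "Cross S c x"
      "R = Case V (cast_var0 (inl_cast S c x) M) (cast_var0 (inr_cast S c x) N)"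
  | (inl) A V where "L = InL A V" "R = subst0 M V"
  | (inr) A V where "L = InR A V" "R = subst0 N V"
  using assms(1)
proof cases
  case (frame F A M M')
  with assms show ?thesis by (cases F) (auto dest: step_not_value)
next
  case (frame_blame F A l)
  with assms show ?thesis by (cases F) (auto simp: is_value_simps)
qed (auto intro: that)

lemma exts_Var: "exts Var = Var"
proof
  show "exts Var x = Var x" for x by (cases x) auto
qed

lemma subst_Var: "subst Var M = M"
  by (induction M) (simp_all add: exts_Var)


section \<open>Precision and substitution\<close>

text \<open>The variable rule relates whatever types the two contexts assign, so precision of the
  contexts must be assumed; the binder rules carry the premises that preserve it.\<close>

lemma (in pre_cast_struct_with_precision) prec_ty_prec:
  "prec S \<Gamma> \<Gamma>' M A M' A' \<Longrightarrow> list_all2 (\<sqsubseteq>) \<Gamma> \<Gamma>' \<Longrightarrow> A \<sqsubseteq> A'"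
proof (induction rule: prec.induct)
  case (Wrap \<Gamma> \<Gamma>' M A M' A' i i' B B')
  then show ?case using wrap_prec_wrap_elim by blast
next
  case (WrapL \<Gamma> \<Gamma>' M A M' A' i B)
  then show ?case using wrap_prec_ty_elim by blast
next
  case (WrapR \<Gamma> \<Gamma>' M A M' A' i' B')
  then show ?case using ty_prec_wrap_elim by blast
qed (auto simp: ty_prec_simps list_all2_nthD ty_prec_refl)

text \<open>A name for the premise of \<open>typed_rename\<close>, so that passing under a binder
  becomes one resolution with \<open>renaming_ext\<close>.\<close>

definition renaming :: "(nat \<Rightarrow> nat) \<Rightarrow> ctx \<Rightarrow> ctx \<Rightarrow> bool" where
  "renaming \<rho> \<Gamma> \<Delta> \<longleftrightarrow> (\<forall>x < length \<Gamma>. \<rho> x < length \<Delta> \<and> \<Delta> ! \<rho> x = \<Gamma> ! x)"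

lemma renaming_ext: "renaming \<rho> \<Gamma> \<Delta> \<Longrightarrow> renaming (ext \<rho>) (A # \<Gamma>) (A # \<Delta>)"
  unfolding renaming_def by (intro allI, case_tac x) auto

lemma prec_rename:
  "prec S \<Gamma> \<Gamma>' M A M' A' \<Longrightarrow> renaming \<rho> \<Gamma> \<Delta> \<Longrightarrow> renaming \<rho> \<Gamma>' \<Delta>' \<Longrightarrow>
   prec S \<Delta> \<Delta>' (rename \<rho> M) A (rename \<rho> M') A'"
proof (induction arbitrary: \<rho> \<Delta> \<Delta>' rule: prec.induct)
  case (Var x \<Gamma> A \<Gamma>' A')
  then show ?case by (auto simp: renaming_def intro: prec.Var)
next
  case (Blame \<Gamma> M A A' \<Gamma>' l)
  then show ?case by (auto simp: renaming_def intro!: prec.Blame typed_rename)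
qed (simp_all, (rule prec.intros; blast intro: renaming_ext)+)

definition substs_prec where
  "substs_prec S \<Gamma> \<Gamma>' \<Delta> \<Delta>' \<sigma> \<sigma>' \<longleftrightarrow> length \<Gamma> = length \<Gamma>' \<and>
     (\<forall>x < length \<Gamma>. prec S \<Delta> \<Delta>' (\<sigma> x) (\<Gamma> ! x) (\<sigma>' x) (\<Gamma>' ! x))"

lemma substs_prec_exts:
  assumes "substs_prec S \<Gamma> \<Gamma>' \<Delta> \<Delta>' \<sigma> \<sigma>'"
  shows "substs_prec S (A # \<Gamma>) (A' # \<Gamma>') (A # \<Delta>) (A' # \<Delta>') (exts \<sigma>) (exts \<sigma>')"
  unfolding substs_prec_def
proof (intro conjI allI impI)
  fix x assume "x < length (A # \<Gamma>)"
  with assms show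
    "prec S (A # \<Delta>) (A' # \<Delta>') (exts \<sigma> x) ((A # \<Gamma>) ! x) (exts \<sigma>' x) ((A' # \<Gamma>') ! x)"
    by (cases x) (auto simp: substs_prec_def renaming_def intro: prec.Var intro!: prec_rename)
qed (use assms in \<open>auto simp: substs_prec_def\<close>)

lemma prec_subst:
  "prec S \<Gamma> \<Gamma>' M A M' A' \<Longrightarrow> substs_prec S \<Gamma> \<Gamma>' \<Delta> \<Delta>' \<sigma> \<sigma>' \<Longrightarrow>
   prec S \<Delta> \<Delta>' (subst \<sigma> M) A (subst \<sigma>' M') A'"
proof (induction arbitrary: \<sigma> \<sigma>' \<Delta> \<Delta>' rule: prec.induct)
  case (Var x \<Gamma> A \<Gamma>' A')
  then show ?case by (auto simp: substs_prec_def)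
next
  \<comment> \<open>A term below a blame is constrained by its typing alone, so there is no
    induction hypothesis; the typing half of the related substitutions is enough.\<close>
  case (Blame \<Gamma> M A A' \<Gamma>' l)
  then show ?case by (auto simp: substs_prec_def intro!: prec.Blame typed_subst dest: prec_typed)
qed (simp_all, (rule prec.intros; blast intro: substs_prec_exts)+)

lemma prec_subst0:
  assumes "prec S [A] [A'] M B M' B'" "prec S [] [] V A V' A'"
  shows "prec S [] [] (subst0 M V) B (subst0 M' V') B'"
  unfolding subst0_def
  by (rule prec_subst[OF assms(1)]) (use assms(2) in \<open>auto simp: substs_prec_def\<close>)

lemma prec_cast_var0:
  assumes "prec S [A] [A'] M B M' B'" "prec S [C] [C'] (Cast (Var 0) c) A (Cast (Var 0) c') A'"
  shows "prec S [C] [C'] (cast_var0 c M) B (cast_var0 c' M') B'"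
  unfolding cast_var0_def
  by (rule prec_subst[OF assms(1)]) (use assms(2) in \<open>auto simp: substs_prec_def\<close>)

text \<open>When only the left value is wrapped, only the left branch is rewritten. Substitution
  acts on both sides, so the untouched branch is read as its own image under the identity
  substitution.\<close>

lemma prec_cast_var0_left:
  assumes "prec S [A] [A'] M B M' B'" "prec S [C] [A'] (Cast (Var 0) c) A (Var 0) A'"
  shows "prec S [C] [A'] (cast_var0 c M) B M' B'"
proof -
  have "prec S [C] [A'] (cast_var0 c M) B (subst Var M') B'"
    unfolding cast_var0_def
    by (rule prec_subst[OF assms(1)]) (use assms(2) in \<open>auto simp: substs_prec_def\<close>)
  then show ?thesis by (simp add: subst_Var)
qed

lemma prec_cast_var0_right:
  assumes "prec S [A] [A'] M B M' B'" "prec S [A] [C'] (Var 0) A (Cast (Var 0) c') A'"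
  shows "prec S [A] [C'] M B (cast_var0 c' M') B'"
proof -
  have "prec S [A] [C'] (subst Var M) B (cast_var0 c' M') B'"
    unfolding cast_var0_def
    by (rule prec_subst[OF assms(1)]) (use assms(2) in \<open>auto simp: substs_prec_def\<close>)
  then show ?thesis by (simp add: subst_Var)
qed


section \<open>Simulation\<close>

context cast_struct_with_precision
begin

section \<open>Catching up with a more precise value\<close>

lemma prec_ty_prec_closed: "prec S [] [] M A M' A' \<Longrightarrow> A \<sqsubseteq> A'"
  by (rule prec_ty_prec) auto

lemma prec_valuesI:
  "prec S [] [] V A V' A' \<Longrightarrow> is_value S V \<Longrightarrow> is_value S V' \<Longrightarrow> prec_values S [] [] V A V' A'"
  unfolding prec_values_def using prec_typed prec_ty_prec_closed by blast

text \<open>Only \<open>CastL\<close> demands computation at the root; in the other possible cases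
  the left term is already a value or is built by a value-forming constructor from terms that catch
  up by induction. Rules whose right-hand term is not a value are vacuous.\<close>

lemma catch_up:
  "prec S [] [] M A V' A' \<Longrightarrow> is_value S V' \<Longrightarrow>
   \<exists>V. is_value S V \<and> steps S [] A M V \<and> prec S [] [] V A V' A'"
proof (induction "[] :: ctx" "[] :: ctx" M A V' A' rule: prec.induct)
  case (Const k P)
  then show ?case by (blast intro: is_value.Const prec.Const)
next
  case (Lam A A' N B N' B')
  then show ?case by (blast intro: is_value.Lam prec.Lam)
next
  case (Tup M A M' A' N B N' B')
  then obtain V W where V: "is_value S V" "steps S [] A M V" "prec S [] [] V A M' A'"
    and W: "is_value S W" "steps S [] B N W" "prec S [] [] W B N' B'"
    by (auto simp: is_value_simps)
  have "steps S [] (TProd A B) (Tup M N) (Tup V N)"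
    using Tup V by (blast intro: steps_frame typed_frame.TupL dest: prec_typed)
  also have "steps S [] (TProd A B) (Tup V N) (Tup V W)"
    using V W by (blast intro: steps_frame typed_frame.TupR dest: prec_typed)
  finally show ?case using V W by (blast intro: is_value.Tup prec.Tup)
next
  case (InL M A M' A' B B')
  then show ?case
    by (auto simp: is_value_simps) (blast intro: steps_frame typed_frame.InL prec.InL is_value.InL)
next
  case (InR M B M' B' A A')
  then show ?case
    by (auto simp: is_value_simps) (blast intro: steps_frame typed_frame.InR prec.InR is_value.InR)
next
  case (CastL M A M' A' c B)
  then obtain V where V: "is_value S V" "steps S [] A M V" "prec S [] [] V A M' A'"
    by auto
  have tc: "typed S [] (Cast V c) B" using V CastL by (blast intro: typed.Cast dest: prec_typed)
  have st: "steps S [] B (Cast M c) (Cast V c)"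
    using V CastL by (blast intro: steps_frame typed_frame.Cast)
  \<comment> \<open>An active cast is run, and \<open>apply_cast_left\<close> promises a value still
    below \<open>M'\<close>; an inert one becomes a wrapper, which \<open>wrap_prec_ty_intro\<close>
    places below the type of \<open>M'\<close>.\<close>
  from active_or_inert[of c] show ?case
  proof
    assume "\<exists>a. Active S c a"
    then obtain a where a: "Active S c a" ..
    then obtain W where W: "is_value S W" "steps S [] B (apply_cast S [] V c a) W" "prec S [] [] W B M' A'"
      using apply_cast_left prec_valuesI V CastL by meson
    have "step S [] B (Cast V c) (apply_cast S [] V c a)" using V tc a by (blast intro: step.cast)
    with st W show ?thesis by (meson rtranclp.rtrancl_into_rtrancl rtranclp_trans)
  next
    assume c: "Inert S c"
    then have "step S [] B (Cast V c) (Wrap V c)" using V tc by (blast intro: step.wrap)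
    moreover have "prec S [] [] (Wrap V c) B M' A'"
      using V c CastL by (blast intro: prec.WrapL wrap_prec_ty_intro)
    moreover have "is_value S (Wrap V c)" using V c by (blast intro: is_value.Wrap)
    ultimately show ?thesis using st by (meson rtranclp.rtrancl_into_rtrancl)
  qed
next
  case (Wrap M A M' A' i i' B B')
  then obtain V where V: "is_value S V" "steps S [] A M V" "prec S [] [] V A M' A'"
    by (auto simp: is_value_simps)
  with Wrap.hyps show ?case
    by (intro exI[of _ "Wrap V i"] conjI is_value.Wrap prec.Wrap steps_frame typed_frame.Wrap)
next
  case (WrapL M A M' A' i B)
  then obtain V where V: "is_value S V" "steps S [] A M V" "prec S [] [] V A M' A'"
    by auto
  with WrapL.hyps show ?case
    by (intro exI[of _ "Wrap V i"] conjI is_value.Wrap prec.WrapL steps_frame typed_frame.Wrap)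
next
  case (WrapR M A M' A' i' B')
  then show ?case by (auto simp: is_value_simps) (blast intro: prec.WrapR)
qed (auto simp: is_value_simps)

text \<open>Below a constant there can only be that constant, a cast, or a wrapper. A cast is not a
  value, and no cast into a base type is inert. Conditionals and primitive application rely on this,
  having no rule for a wrapped base value.\<close>

lemma value_base_prec_Const:
  "prec S [] [] V (TBase b) (Const k) A' \<Longrightarrow> is_value S V \<Longrightarrow> V = Const k"
  by (erule prec.cases) (auto simp: is_value_simps base_not_inert)

section \<open>Elimination forms applied to related values\<close>

lemma inert_funE:
  assumes "Inert S c" "is_cast S c A (TFun B C)"
  obtains x A1 A2 where "Cross S c x" "A = TFun A1 A2"
    "is_cast S (dom_cast S c x) B A1" "is_cast S (cod_cast S c x) A2 C"
  using inert_fun[OF assms(2,1)] assms dom_cast cod_cast by blast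

lemma inert_prodE:
  assumes "Inert S c" "is_cast S c A (TProd B C)"
  obtains x A1 A2 where "Cross S c x" "A = TProd A1 A2"
    "is_cast S (fst_cast S c x) A1 B" "is_cast S (snd_cast S c x) A2 C"
  using inert_prod[OF assms(2,1)] assms fst_cast snd_cast by blast

lemma inert_sumE:
  assumes "Inert S c" "is_cast S c A (TSum B C)"
  obtains x A1 A2 where "Cross S c x" "A = TSum A1 A2"
    "is_cast S (inl_cast S c x) A1 B" "is_cast S (inr_cast S c x) A2 C"
  using inert_sum[OF assms(2,1)] assms inl_cast inr_cast by blast

text \<open>\<open>W\<close> is generalised while \<open>W'\<close> stays fixed, because opening a
  left-only wrapper replaces the left argument by its value under the domain cast. Only
  \<open>WrapL\<close> uses the induction hypothesis: it alone keeps the operator \<open>V'\<close>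
  on the right.\<close>

lemma app_simulation:
  "prec S [] [] V T V' T' \<Longrightarrow> T = TFun A B \<Longrightarrow> T' = TFun A' B' \<Longrightarrow> is_value S V \<Longrightarrow> is_value S V' \<Longrightarrow>
   prec S [] [] W A W' A' \<Longrightarrow> is_value S W \<Longrightarrow> is_value S W' \<Longrightarrow> step S [] B' (App V' W') N' \<Longrightarrow>
   \<exists>N. steps S [] B (App V W) N \<and> prec S [] [] N B N' B'"
proof (induction "[] :: ctx" "[] :: ctx" V T V' T' arbitrary: A B A' B' W rule: prec.induct)
  case (Const k P)
  from Const.prems(8,4,7) obtain b Q k' k'' where k: "W' = Const k'" "k \<in> denote (PFun b Q)"
      "k' \<in> denote (PBase b)" "const_app k k' = Some k''" "N' = Const k''" "B' = prim_ty Q"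
    by (auto elim!: step_App_valuesE)
  \<comment> \<open>The precision rule and the step each name a primitive type for \<open>k\<close>;
    a constant belongs to only one.\<close>
  have "P = PFun b Q" using Const.hyps k(2) denote_unique by blast
  with Const.prems have T: "A = TBase b" "B = prim_ty Q" by auto
  have "W = Const k'" using Const.prems k T value_base_prec_Const by blast
  moreover have "step S [] B (App (Const k) (Const k')) N'" using k T by (auto intro: step.delta)
  moreover have "prec S [] [] N' B N' B'"
    using k T const_app_denote[OF k(2,3)] by (auto intro: prec.Const)
  ultimately show ?case by blast
next
  case (Lam C C' N D M' D')
  have N': "N' = subst0 M' W'" using Lam.prems by (auto elim: step_App_valuesE)
  have "typed S [] (App (Lam A N) W) B"
    using Lam by (auto intro!: typed.App[of _ _ _ A] typed.Lam dest: prec_typed)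
  then have "step S [] B (App (Lam C N) W) (subst0 N W)" using Lam.prems by (auto intro: step.beta)
  moreover have "prec S [] [] (subst0 N W) B N' B'"
    unfolding N' using Lam by (auto intro: prec_subst0)
  ultimately show ?case by blast
next
  case (Wrap V C V' C' i i' D D')
  obtain x' where x': "Cross S i' x'"
    and N': "N' = Cast (App V' (Cast W' (dom_cast S i' x'))) (cod_cast S i' x')"
    using Wrap.prems by (auto elim: step_App_valuesE)
  obtain x C1 C2 where x: "Cross S i x" "C = TFun C1 C2"
      "is_cast S (dom_cast S i x) A C1" "is_cast S (cod_cast S i x) C2 B"
    using Wrap inert_funE by metis
  \<comment> \<open>The step dictates the proof \<open>x'\<close> on the right, so only the shape of
    the source is taken from \<open>inert_funE\<close> and the component casts are typed for
    \<open>x'\<close> itself. On the left the proof \<open>x\<close> could be chosen freely.\<close>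
  obtain C1' C2' where C': "C' = TFun C1' C2'" using Wrap inert_funE by metis
  with x' have x'': "is_cast S (dom_cast S i' x') A' C1'" "is_cast S (cod_cast S i' x') C2' B'"
    using Wrap dom_cast cod_cast by auto
  have "C \<sqsubseteq> C'" "D \<sqsubseteq> D'" using Wrap wrap_prec_wrap_elim by blast+
  then have le: "C1 \<sqsubseteq> C1'" "C2 \<sqsubseteq> C2'" "A \<sqsubseteq> A'" "B \<sqsubseteq> B'"
    using x C' Wrap.prems by (auto simp: ty_prec_simps)
  have "typed S [] (App (Wrap V i) W) B"
    using Wrap by (blast intro: typed.App typed.Wrap dest: prec_typed)
  then have "step S [] B (App (Wrap V i) W) (Cast (App V (Cast W (dom_cast S i x))) (cod_cast S i x))"
    using Wrap x by (auto simp: is_value_simps intro: step.app_wrap)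
  moreover have "prec S [] [] (Cast W (dom_cast S i x)) C1 (Cast W' (dom_cast S i' x')) C1'"
    using Wrap.prems(5) x(3) x''(1) le by (blast intro: prec.Cast)
  then have "prec S [] [] (App V (Cast W (dom_cast S i x))) C2
      (App V' (Cast W' (dom_cast S i' x'))) C2'"
    using Wrap.hyps(1) x(2) C' by (blast intro: prec.App)
  then have "prec S [] [] (Cast (App V (Cast W (dom_cast S i x))) (cod_cast S i x)) B N' B'"
    unfolding N' using x(4) x''(2) le by (blast intro: prec.Cast)
  ultimately show ?case by blast
next
  case (WrapL V C V' C' i D)
  obtain x C1 C2 where x: "Cross S i x" "C = TFun C1 C2"
      "is_cast S (dom_cast S i x) A C1" "is_cast S (cod_cast S i x) C2 B"
    using WrapL inert_funE by metis
  \<comment> \<open>Both endpoints of a left-only wrapper lie below the type of \<open>V'\<close>;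
    hence the domain cast stays below \<open>A'\<close> and the codomain cast below
    \<open>B'\<close>, as \<open>CastL\<close> requires.\<close>
  have "C \<sqsubseteq> C'" "D \<sqsubseteq> C'" using WrapL wrap_prec_ty_elim by blast+
  then have le: "C1 \<sqsubseteq> A'" "C2 \<sqsubseteq> B'" "A \<sqsubseteq> A'" "B \<sqsubseteq> B'"
    using x WrapL.prems by (auto simp: ty_prec_simps)
  have V: "is_value S V" "typed S [] V (TFun C1 C2)"
    using WrapL x by (auto simp: is_value_simps dest: prec_typed)
  have "prec S [] [] (Cast W (dom_cast S i x)) C1 W' A'"
    using WrapL.prems x le by (blast intro: prec.CastL)
  \<comment> \<open>The induction hypothesis wants a value as argument, so the freshly inserted
    domain cast is evaluated before it is applied.\<close>
  then obtain W2 where W2: "is_value S W2" "steps S [] C1 (Cast W (dom_cast S i x)) W2"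
      "prec S [] [] W2 C1 W' A'"
    using WrapL.prems catch_up by blast
  obtain N where N: "steps S [] C2 (App V W2) N" "prec S [] [] N C2 N' B'"
    using WrapL.hyps(2)[OF x(2) WrapL.prems(2) V(1) WrapL.prems(4) W2(3,1) WrapL.prems(7,8)] by blast
  have "typed S [] (App (Wrap V i) W) B"
    using WrapL by (blast intro: typed.App typed.Wrap dest: prec_typed)
  then have "step S [] B (App (Wrap V i) W) (Cast (App V (Cast W (dom_cast S i x))) (cod_cast S i x))"
    using WrapL x V by (auto intro: step.app_wrap)
  moreover have "steps S [] C2 (App V (Cast W (dom_cast S i x))) (App V W2)"
    using W2 V by (blast intro: steps_frame typed_frame.AppR)
  with N have "steps S [] C2 (App V (Cast W (dom_cast S i x))) N" by simp
  then have "steps S [] B (Cast (App V (Cast W (dom_cast S i x))) (cod_cast S i x)) (Cast N (cod_cast S i x))"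
    using x by (blast intro: steps_frame typed_frame.Cast)
  moreover have "prec S [] [] (Cast N (cod_cast S i x)) B N' B'"
    using N x le by (blast intro: prec.CastL)
  ultimately show ?case by (meson converse_rtranclp_into_rtranclp)
next
  case (WrapR V C V' C' i' D')
  obtain x' where x': "Cross S i' x'"
    and N': "N' = Cast (App V' (Cast W' (dom_cast S i' x'))) (cod_cast S i' x')"
    using WrapR.prems by (auto elim: step_App_valuesE)
  obtain C1' C2' where C': "C' = TFun C1' C2'" using WrapR inert_funE by metis
  with x' have x'': "is_cast S (dom_cast S i' x') A' C1'" "is_cast S (cod_cast S i' x') C2' B'"
    using WrapR dom_cast cod_cast by auto
  have "C \<sqsubseteq> C'" "C \<sqsubseteq> D'" using WrapR ty_prec_wrap_elim by blast+
  then have le: "A \<sqsubseteq> C1'" "B \<sqsubseteq> C2'" "A \<sqsubseteq> A'" "B \<sqsubseteq> B'"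
    using C' WrapR.prems by (auto simp: ty_prec_simps)
  \<comment> \<open>The left side takes no step: the two casts that appear on the right are absorbed
    by \<open>CastR\<close>, one on the argument and one on the result.\<close>
  have "prec S [] [] W A (Cast W' (dom_cast S i' x')) C1'"
    using WrapR.prems(5) x''(1) le by (blast intro: prec.CastR)
  then have "prec S [] [] (App V W) B (App V' (Cast W' (dom_cast S i' x'))) C2'"
    using WrapR.hyps(1) WrapR.prems(1) C' by (blast intro: prec.App)
  then have "prec S [] [] (App V W) B N' B'"
    unfolding N' using x''(2) le by (blast intro: prec.CastR)
  then show ?case by blast
qed (auto simp: is_value_simps)

text \<open>The recursion through left-only wrappers is simpler than for application: there is no
  argument to evaluate, and opening a wrapper leaves one component cast around the result.\<close>

lemma proj1_simulation:
  "prec S [] [] V T V' T' \<Longrightarrow> T = TProd A B \<Longrightarrow> T' = TProd A' B' \<Longrightarrow> is_value S V \<Longrightarrow> is_value S V' \<Longrightarrow>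
   step S [] A' (Proj1 V') N' \<Longrightarrow>
   \<exists>N. steps S [] A (Proj1 V) N \<and> prec S [] [] N A N' A'"
proof (induction "[] :: ctx" "[] :: ctx" V T V' T' arbitrary: A B A' B' rule: prec.induct)
  case (Tup V C V' C' W D W' D')
  have N': "N' = V'" using Tup.prems by (auto elim: step_Proj1_valueE)
  have "typed S [] (Proj1 (Tup V W)) C"
    using Tup by (blast intro: typed.Proj1 typed.Tup dest: prec_typed)
  then have "step S [] C (Proj1 (Tup V W)) V"
    using Tup.prems by (auto simp: is_value_simps intro: step.proj1_tup)
  then show ?case using Tup N' by auto
next
  case (Wrap V C V' C' i i' D D')
  obtain x' where x': "Cross S i' x'" and N': "N' = Cast (Proj1 V') (fst_cast S i' x')"
    using Wrap.prems by (auto elim: step_Proj1_valueE)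
  obtain x C1 C2 where x: "Cross S i x" "C = TProd C1 C2" "is_cast S (fst_cast S i x) C1 A"
    using Wrap inert_prodE by metis
  obtain C1' C2' where C': "C' = TProd C1' C2'" using Wrap inert_prodE by metis
  with x' have x'': "is_cast S (fst_cast S i' x') C1' A'" using Wrap fst_cast by auto
  have "C \<sqsubseteq> C'" "D \<sqsubseteq> D'" using Wrap wrap_prec_wrap_elim by blast+
  then have le: "C1 \<sqsubseteq> C1'" "A \<sqsubseteq> A'" using x C' Wrap.prems by (auto simp: ty_prec_simps)
  have "typed S [] (Proj1 (Wrap V i)) A"
    using Wrap by (blast intro: typed.Proj1 typed.Wrap dest: prec_typed)
  then have "step S [] A (Proj1 (Wrap V i)) (Cast (Proj1 V) (fst_cast S i x))"
    using Wrap x by (auto simp: is_value_simps intro: step.proj1_wrap)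
  moreover have "prec S [] [] (Cast (Proj1 V) (fst_cast S i x)) A N' A'"
    unfolding N' using Wrap.hyps x x'' C' le by (metis prec.Cast prec.Proj1)
  ultimately show ?case by blast
next
  case (WrapL V C V' C' i D)
  obtain x C1 C2 where x: "Cross S i x" "C = TProd C1 C2" "is_cast S (fst_cast S i x) C1 A"
    using WrapL inert_prodE by metis
  have "C \<sqsubseteq> C'" "D \<sqsubseteq> C'" using WrapL wrap_prec_ty_elim by blast+
  then have le: "C1 \<sqsubseteq> A'" "A \<sqsubseteq> A'" using x WrapL.prems by (auto simp: ty_prec_simps)
  have V: "is_value S V" using WrapL by (auto simp: is_value_simps)
  obtain N where N: "steps S [] C1 (Proj1 V) N" "prec S [] [] N C1 N' A'"
    using WrapL.hyps(2)[OF x(2) WrapL.prems(2) V WrapL.prems(4,5)] by blast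
  have "typed S [] (Proj1 (Wrap V i)) A"
    using WrapL by (blast intro: typed.Proj1 typed.Wrap dest: prec_typed)
  then have "step S [] A (Proj1 (Wrap V i)) (Cast (Proj1 V) (fst_cast S i x))"
    using WrapL x V by (auto intro: step.proj1_wrap)
  moreover have "steps S [] A (Cast (Proj1 V) (fst_cast S i x)) (Cast N (fst_cast S i x))"
    using N x by (blast intro: steps_frame typed_frame.Cast)
  moreover have "prec S [] [] (Cast N (fst_cast S i x)) A N' A'"
    using N x le by (blast intro: prec.CastL)
  ultimately show ?case by (meson converse_rtranclp_into_rtranclp)
next
  case (WrapR V C V' C' i' D')
  obtain x' where x': "Cross S i' x'" and N': "N' = Cast (Proj1 V') (fst_cast S i' x')"
    using WrapR.prems by (auto elim: step_Proj1_valueE)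
  obtain C1' C2' where C': "C' = TProd C1' C2'" using WrapR inert_prodE by metis
  with x' have x'': "is_cast S (fst_cast S i' x') C1' A'" using WrapR fst_cast by auto
  have "C \<sqsubseteq> C'" "C \<sqsubseteq> D'" using WrapR ty_prec_wrap_elim by blast+
  then have le: "A \<sqsubseteq> C1'" "A \<sqsubseteq> A'" using C' WrapR.prems by (auto simp: ty_prec_simps)
  have "prec S [] [] (Proj1 V) A N' A'"
    unfolding N' using WrapR.hyps WrapR.prems x'' C' le by (metis prec.CastR prec.Proj1)
  then show ?case by blast
qed (auto simp: is_value_simps elim: step_Proj1_valueE)

lemma proj2_simulation:
  "prec S [] [] V T V' T' \<Longrightarrow> T = TProd A B \<Longrightarrow> T' = TProd A' B' \<Longrightarrow> is_value S V \<Longrightarrow> is_value S V' \<Longrightarrow>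
   step S [] B' (Proj2 V') N' \<Longrightarrow>
   \<exists>N. steps S [] B (Proj2 V) N \<and> prec S [] [] N B N' B'"
proof (induction "[] :: ctx" "[] :: ctx" V T V' T' arbitrary: A B A' B' rule: prec.induct)
  case (Tup V C V' C' W D W' D')
  have N': "N' = W'" using Tup.prems by (auto elim: step_Proj2_valueE)
  have "typed S [] (Proj2 (Tup V W)) D"
    using Tup by (blast intro: typed.Proj2 typed.Tup dest: prec_typed)
  then have "step S [] D (Proj2 (Tup V W)) W"
    using Tup.prems by (auto simp: is_value_simps intro: step.proj2_tup)
  then show ?case using Tup N' by auto
next
  case (Wrap V C V' C' i i' D D')
  obtain x' where x': "Cross S i' x'" and N': "N' = Cast (Proj2 V') (snd_cast S i' x')"
    using Wrap.prems by (auto elim: step_Proj2_valueE)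
  obtain x C1 C2 where x: "Cross S i x" "C = TProd C1 C2" "is_cast S (snd_cast S i x) C2 B"
    using Wrap inert_prodE by metis
  obtain C1' C2' where C': "C' = TProd C1' C2'" using Wrap inert_prodE by metis
  with x' have x'': "is_cast S (snd_cast S i' x') C2' B'" using Wrap snd_cast by auto
  have "C \<sqsubseteq> C'" "D \<sqsubseteq> D'" using Wrap wrap_prec_wrap_elim by blast+
  then have le: "C2 \<sqsubseteq> C2'" "B \<sqsubseteq> B'" using x C' Wrap.prems by (auto simp: ty_prec_simps)
  have "typed S [] (Proj2 (Wrap V i)) B"
    using Wrap by (blast intro: typed.Proj2 typed.Wrap dest: prec_typed)
  then have "step S [] B (Proj2 (Wrap V i)) (Cast (Proj2 V) (snd_cast S i x))"
    using Wrap x by (auto simp: is_value_simps intro: step.proj2_wrap)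
  moreover have "prec S [] [] (Cast (Proj2 V) (snd_cast S i x)) B N' B'"
    unfolding N' using Wrap.hyps x x'' C' le by (metis prec.Cast prec.Proj2)
  ultimately show ?case by blast
next
  case (WrapL V C V' C' i D)
  obtain x C1 C2 where x: "Cross S i x" "C = TProd C1 C2" "is_cast S (snd_cast S i x) C2 B"
    using WrapL inert_prodE by metis
  have "C \<sqsubseteq> C'" "D \<sqsubseteq> C'" using WrapL wrap_prec_ty_elim by blast+
  then have le: "C2 \<sqsubseteq> B'" "B \<sqsubseteq> B'" using x WrapL.prems by (auto simp: ty_prec_simps)
  have V: "is_value S V" using WrapL by (auto simp: is_value_simps)
  obtain N where N: "steps S [] C2 (Proj2 V) N" "prec S [] [] N C2 N' B'"
    using WrapL.hyps(2)[OF x(2) WrapL.prems(2) V WrapL.prems(4,5)] by blast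
  have "typed S [] (Proj2 (Wrap V i)) B"
    using WrapL by (blast intro: typed.Proj2 typed.Wrap dest: prec_typed)
  then have "step S [] B (Proj2 (Wrap V i)) (Cast (Proj2 V) (snd_cast S i x))"
    using WrapL x V by (auto intro: step.proj2_wrap)
  moreover have "steps S [] B (Cast (Proj2 V) (snd_cast S i x)) (Cast N (snd_cast S i x))"
    using N x by (blast intro: steps_frame typed_frame.Cast)
  moreover have "prec S [] [] (Cast N (snd_cast S i x)) B N' B'"
    using N x le by (blast intro: prec.CastL)
  ultimately show ?case by (meson converse_rtranclp_into_rtranclp)
next
  case (WrapR V C V' C' i' D')
  obtain x' where x': "Cross S i' x'" and N': "N' = Cast (Proj2 V') (snd_cast S i' x')"
    using WrapR.prems by (auto elim: step_Proj2_valueE)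
  obtain C1' C2' where C': "C' = TProd C1' C2'" using WrapR inert_prodE by metis
  with x' have x'': "is_cast S (snd_cast S i' x') C2' B'" using WrapR snd_cast by auto
  have "C \<sqsubseteq> C'" "C \<sqsubseteq> D'" using WrapR ty_prec_wrap_elim by blast+
  then have le: "B \<sqsubseteq> C2'" "B \<sqsubseteq> B'" using C' WrapR.prems by (auto simp: ty_prec_simps)
  have "prec S [] [] (Proj2 V) B N' B'"
    unfolding N' using WrapR.hyps WrapR.prems x'' C' le by (metis prec.CastR prec.Proj2)
  then show ?case by blast
qed (auto simp: is_value_simps elim: step_Proj2_valueE)

text \<open>Here a wrapper moves into the branches, as a cast on the bound variable, and leaves
  nothing around the result. Hence the left branches \<open>M\<close> and \<open>N\<close> are
  generalised, and in \<open>WrapL\<close> the term from the induction hypothesis is returned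
  unchanged.\<close>

lemma case_simulation:
  "prec S [] [] V T V' T' \<Longrightarrow> T = TSum A1 A2 \<Longrightarrow> T' = TSum A1' A2' \<Longrightarrow>
   is_value S V \<Longrightarrow> is_value S V' \<Longrightarrow>
   prec S [A1] [A1'] M B M' B' \<Longrightarrow> prec S [A2] [A2'] N B N' B' \<Longrightarrow>
   step S [] B' (Case V' M' N') R' \<Longrightarrow>
   \<exists>R. steps S [] B (Case V M N) R \<and> prec S [] [] R B R' B'"
proof (induction "[] :: ctx" "[] :: ctx" V T V' T' arbitrary: A1 A2 A1' A2' M N rule: prec.induct)
  case (InL V C V' C' D D')
  have R': "R' = subst0 M' V'" using InL.prems by (auto elim: step_Case_valueE)
  have "typed S [] (Case (InL D V) M N) B"
    using InL by (blast intro: typed.Case typed.InL dest: prec_typed)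
  then have "step S [] B (Case (InL D V) M N) (subst0 M V)"
    using InL.prems by (auto simp: is_value_simps intro: step.case_inl)
  moreover have "prec S [] [] (subst0 M V) B R' B'"
    unfolding R' using InL by (auto intro: prec_subst0)
  ultimately show ?case by blast
next
  case (InR V C V' C' D D')
  have R': "R' = subst0 N' V'" using InR.prems by (auto elim: step_Case_valueE)
  have "typed S [] (Case (InR D V) M N) B"
    using InR by (blast intro: typed.Case typed.InR dest: prec_typed)
  then have "step S [] B (Case (InR D V) M N) (subst0 N V)"
    using InR.prems by (auto simp: is_value_simps intro: step.case_inr)
  moreover have "prec S [] [] (subst0 N V) B R' B'"
    unfolding R' using InR by (auto intro: prec_subst0)
  ultimately show ?case by blast
next
  case (Wrap V C V' C' i i' D D')
  obtain x' where x': "Cross S i' x'"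
    and R': "R' = Case V' (cast_var0 (inl_cast S i' x') M') (cast_var0 (inr_cast S i' x') N')"
    using Wrap.prems by (auto elim: step_Case_valueE)
  obtain x C1 C2 where x: "Cross S i x" "C = TSum C1 C2"
      "is_cast S (inl_cast S i x) C1 A1" "is_cast S (inr_cast S i x) C2 A2"
    using Wrap inert_sumE by metis
  obtain C1' C2' where C': "C' = TSum C1' C2'" using Wrap inert_sumE by metis
  with x' have x'': "is_cast S (inl_cast S i' x') C1' A1'" "is_cast S (inr_cast S i' x') C2' A2'"
    using Wrap inl_cast inr_cast by auto
  have "C \<sqsubseteq> C'" "D \<sqsubseteq> D'" using Wrap wrap_prec_wrap_elim by blast+
  then have le: "C1 \<sqsubseteq> C1'" "C2 \<sqsubseteq> C2'" "A1 \<sqsubseteq> A1'" "A2 \<sqsubseteq> A2'"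
    using x C' Wrap.prems by (auto simp: ty_prec_simps)
  have "typed S [] (Case (Wrap V i) M N) B"
    using Wrap by (blast intro: typed.Case typed.Wrap dest: prec_typed)
  then have "step S [] B (Case (Wrap V i) M N)
      (Case V (cast_var0 (inl_cast S i x) M) (cast_var0 (inr_cast S i x) N))"
    using Wrap x by (auto simp: is_value_simps intro: step.case_wrap)
  moreover have "prec S [C1] [C1'] (cast_var0 (inl_cast S i x) M) B (cast_var0 (inl_cast S i' x') M') B'"
    by (rule prec_cast_var0[OF Wrap.prems(5)], rule prec.Cast[OF prec.Var x(3) x''(1)])
      (use le in auto)
  moreover have "prec S [C2] [C2'] (cast_var0 (inr_cast S i x) N) B (cast_var0 (inr_cast S i' x') N') B'"
    by (rule prec_cast_var0[OF Wrap.prems(6)], rule prec.Cast[OF prec.Var x(4) x''(2)])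
      (use le in auto)
  moreover note Wrap.hyps(1) x(2) C' le
  ultimately show ?case unfolding R' by (blast intro: prec.Case)
next
  case (WrapL V C V' C' i D)
  obtain x C1 C2 where x: "Cross S i x" "C = TSum C1 C2"
      "is_cast S (inl_cast S i x) C1 A1" "is_cast S (inr_cast S i x) C2 A2"
    using WrapL inert_sumE by metis
  have "C \<sqsubseteq> C'" "D \<sqsubseteq> C'" using WrapL wrap_prec_ty_elim by blast+
  then have le: "C1 \<sqsubseteq> A1'" "C2 \<sqsubseteq> A2'" "A1 \<sqsubseteq> A1'" "A2 \<sqsubseteq> A2'"
    using x WrapL.prems by (auto simp: ty_prec_simps)
  have V: "is_value S V" using WrapL by (auto simp: is_value_simps)
  have M: "prec S [C1] [A1'] (cast_var0 (inl_cast S i x) M) B M' B'"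
    by (rule prec_cast_var0_left[OF WrapL.prems(5)], rule prec.CastL[OF prec.Var x(3)])
      (use le in auto)
  have N: "prec S [C2] [A2'] (cast_var0 (inr_cast S i x) N) B N' B'"
    by (rule prec_cast_var0_left[OF WrapL.prems(6)], rule prec.CastL[OF prec.Var x(4)])
      (use le in auto)
  have "typed S [] (Case (Wrap V i) M N) B"
    using WrapL by (blast intro: typed.Case typed.Wrap dest: prec_typed)
  then have "step S [] B (Case (Wrap V i) M N)
      (Case V (cast_var0 (inl_cast S i x) M) (cast_var0 (inr_cast S i x) N))"
    using WrapL x V by (auto intro: step.case_wrap)
  then show ?case
    using WrapL.hyps(2)[OF x(2) WrapL.prems(2) V WrapL.prems(4) M N WrapL.prems(7)]
    by (meson converse_rtranclp_into_rtranclp)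
next
  case (WrapR V C V' C' i' D')
  obtain x' where x': "Cross S i' x'"
    and R': "R' = Case V' (cast_var0 (inl_cast S i' x') M') (cast_var0 (inr_cast S i' x') N')"
    using WrapR.prems by (auto elim: step_Case_valueE)
  obtain C1' C2' where C': "C' = TSum C1' C2'" using WrapR inert_sumE by metis
  with x' have x'': "is_cast S (inl_cast S i' x') C1' A1'" "is_cast S (inr_cast S i' x') C2' A2'"
    using WrapR inl_cast inr_cast by auto
  have "C \<sqsubseteq> C'" "C \<sqsubseteq> D'" using WrapR ty_prec_wrap_elim by blast+
  then have le: "A1 \<sqsubseteq> C1'" "A2 \<sqsubseteq> C2'" "A1 \<sqsubseteq> A1'" "A2 \<sqsubseteq> A2'"
    using C' WrapR.prems by (auto simp: ty_prec_simps)
  have "prec S [A1] [C1'] M B (cast_var0 (inl_cast S i' x') M') B'"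
    by (rule prec_cast_var0_right[OF WrapR.prems(5)], rule prec.CastR[OF prec.Var x''(1)])
      (use le in auto)
  moreover have "prec S [A2] [C2'] N B (cast_var0 (inr_cast S i' x') N') B'"
    by (rule prec_cast_var0_right[OF WrapR.prems(6)], rule prec.CastR[OF prec.Var x''(2)])
      (use le in auto)
  moreover note WrapR.hyps(1) WrapR.prems(1) C' le
  ultimately show ?case unfolding R' by (blast intro: prec.Case)
qed (auto simp: is_value_simps elim: step_Case_valueE)

section \<open>Simulation of an arbitrary step\<close>

lemma simulation_blame:
  "prec S [] [] M A M' A' \<Longrightarrow> \<exists>N. steps S [] A M N \<and> prec S [] [] N A (Blame A' l) A'"
  \<comment> \<open>The left side stands still: every term of a less precise type lies below a
    blame.\<close>
  by (meson prec.Blame prec_typed prec_ty_prec_closed rtranclp.rtrancl_refl)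

text \<open>\<open>CastL\<close> and \<open>WrapL\<close> leave the right-hand term as it is, so the
  reduction given by the induction hypothesis runs inside the left cast or wrapper. The remaining
  rules with a reducible right-hand term are handled by inverting its step.\<close>

lemma simulation:
  "prec S [] [] M A M' A' \<Longrightarrow> step S [] A' M' N' \<Longrightarrow>
   \<exists>N. steps S [] A M N \<and> prec S [] [] N A N' A'"
proof (induction "[] :: ctx" "[] :: ctx" M A M' A' arbitrary: N' rule: prec.induct)
  case (App L A B L' A' B' M M')
  note typed = App.hyps(1,3)[THEN prec_typed]
  from App.prems show ?case
  proof (cases rule: step_AppE)
    case (fn C L2')
    \<comment> \<open>The domain type found by inverting the step is existential; the induction
      hypothesis speaks of the one in the precision derivation.\<close>
    then have "C = A'" using typed typed_unique by blast
    then obtain L2 where "steps S [] (TFun A B) L L2" "prec S [] [] L2 (TFun A B) L2' (TFun A' B')"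
      using App.hyps(2) fn by blast
    then show ?thesis using App.hyps(3) fn(3) typed by (blast intro: steps_frame typed_frame.AppL prec.App)
  next
    case (arg C M2')
    then have C: "C = A'" using typed typed_unique by blast
    then obtain M2 where M2: "steps S [] A M M2" "prec S [] [] M2 A M2' A'"
      using App.hyps(4) arg by blast
    \<comment> \<open>The left argument may reduce only under an operator that is a value. Since
      \<open>L'\<close> is a value here, \<open>L\<close> can catch up with it.\<close>
    obtain V where V: "is_value S V" "steps S [] (TFun A B) L V" "prec S [] [] V (TFun A B) L' (TFun A' B')"
      using catch_up App.hyps(1) arg(1) by blast
    have "steps S [] B (App L M) (App V M)" using V typed by (blast intro: steps_frame typed_frame.AppL)
    also have "steps S [] B (App V M) (App V M2)"
      using V M2 by (blast intro: steps_frame typed_frame.AppR dest: prec_typed)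
    finally show ?thesis using V M2 arg(4) by (blast intro: prec.App)
  next
    case (blame l)
    then show ?thesis using simulation_blame prec.App App.hyps(1,3) by blast
  next
    case head
    obtain V where V: "is_value S V" "steps S [] (TFun A B) L V" "prec S [] [] V (TFun A B) L' (TFun A' B')"
      using catch_up App.hyps(1) head by blast
    obtain W where W: "is_value S W" "steps S [] A M W" "prec S [] [] W A M' A'"
      using catch_up App.hyps(3) head by blast
    have "steps S [] B (App L M) (App V M)" using V typed by (blast intro: steps_frame typed_frame.AppL)
    also have "steps S [] B (App V M) (App V W)"
      using V W by (blast intro: steps_frame typed_frame.AppR dest: prec_typed)
    finally show ?thesis
      using app_simulation[OF V(3) refl refl V(1) head(1) W(3,1) head(2) App.prems]
      by (meson rtranclp_trans)
  qed
next
  case (Cond L L' M B M' B' N1 N1')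
  note typed = Cond.hyps(1,3,5)[THEN prec_typed]
  have L: "steps S [] B (Cond L M N1) (Cond L2 M N1)" if "steps S [] (TBase BBool) L L2" for L2
    using that typed by (blast intro: steps_frame typed_frame.Cond)
  \<comment> \<open>Once the right guard is a constant, the left guard reaches the same constant, so
    both sides select the same branch.\<close>
  have const: "steps S [] B (Cond L M N1) (Cond (Const k) M N1) \<and> typed S [] (Cond (Const k) M N1) B"
    if k: "L' = Const k" for k
  proof -
    obtain V where "is_value S V" "steps S [] (TBase BBool) L V"
        "prec S [] [] V (TBase BBool) L' (TBase BBool)"
      using catch_up Cond.hyps(1) k is_value.Const by blast
    moreover from this k have "V = Const k" using value_base_prec_Const by blast
    ultimately show ?thesis using L typed by (blast intro: typed.Cond dest: prec_typed)
  qed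
  from Cond.prems show ?case
  proof (cases rule: step_CondE)
    case (frame L2')
    then show ?thesis using Cond.hyps L by (blast intro: prec.Cond)
  next
    case (blame l)
    then show ?thesis using simulation_blame prec.Cond Cond.hyps(1,3,5) by blast
  next
    case true
    then show ?thesis using const Cond.hyps(3) by (blast intro: step.cond_true rtranclp.rtrancl_into_rtrancl)
  next
    case false
    then show ?thesis using const Cond.hyps(5) by (blast intro: step.cond_false rtranclp.rtrancl_into_rtrancl)
  qed
next
  case (Tup M A M' A' N1 B N1' B')
  note typed = Tup.hyps(1,3)[THEN prec_typed]
  from Tup.prems show ?case
  proof (cases rule: step_TupE)
    case (left C D M2')
    then obtain M2 where "steps S [] A M M2" "prec S [] [] M2 A M2' A'"
      using Tup.hyps(2) by blast
    then show ?thesis using Tup.hyps(3) left(3) typed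
      by (blast intro: steps_frame typed_frame.TupL prec.Tup)
  next
    case (right C D N2')
    then obtain N2 where N2: "steps S [] B N1 N2" "prec S [] [] N2 B N2' B'"
      using Tup.hyps(4) by blast
    obtain V where V: "is_value S V" "steps S [] A M V" "prec S [] [] V A M' A'"
      using catch_up Tup.hyps(1) right(2) by blast
    have "steps S [] (TProd A B) (Tup M N1) (Tup V N1)"
      using V typed by (blast intro: steps_frame typed_frame.TupL)
    also have "steps S [] (TProd A B) (Tup V N1) (Tup V N2)"
      using V N2 by (blast intro: steps_frame typed_frame.TupR dest: prec_typed)
    finally show ?thesis using V N2 right(4) by (blast intro: prec.Tup)
  next
    case (blame l)
    then show ?thesis using simulation_blame prec.Tup Tup.hyps(1,3) by blast
  qed
next
  case (Proj1 M A B M' A' B')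
  have M: "steps S [] A (Proj1 M) (Proj1 M2)" if "steps S [] (TProd A B) M M2" for M2
    using that by (blast intro: steps_frame typed_frame.Proj1)
  from Proj1.prems show ?case
  proof (cases rule: step_Proj1E)
    case (frame D M2')
    \<comment> \<open>A projection does not show the type of the discarded component, so
      \<open>D\<close> is recovered from the typing of \<open>M'\<close>.\<close>
    have "typed S [] M' (TProd A' D)" using frame(1) step_typed by blast
    then have "D = B'" using Proj1.hyps(1) prec_typed typed_unique by blast
    then show ?thesis using Proj1.hyps(2) frame M by (blast intro: prec.Proj1)
  next
    case (blame l)
    then show ?thesis using simulation_blame prec.Proj1 Proj1.hyps(1) by blast
  next
    case head
    then obtain V where V: "is_value S V" "steps S [] (TProd A B) M V"
        "prec S [] [] V (TProd A B) M' (TProd A' B')"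
      using catch_up Proj1.hyps(1) by blast
    show ?thesis
      using proj1_simulation[OF V(3) refl refl V(1) head Proj1.prems] M[OF V(2)]
      by (meson rtranclp_trans)
  qed
next
  case (Proj2 M A B M' A' B')
  have M: "steps S [] B (Proj2 M) (Proj2 M2)" if "steps S [] (TProd A B) M M2" for M2
    using that by (blast intro: steps_frame typed_frame.Proj2)
  from Proj2.prems show ?case
  proof (cases rule: step_Proj2E)
    case (frame C M2')
    have "typed S [] M' (TProd C B')" using frame(1) step_typed by blast
    then have "C = A'" using Proj2.hyps(1) prec_typed typed_unique by blast
    then show ?thesis using Proj2.hyps(2) frame M by (blast intro: prec.Proj2)
  next
    case (blame l)
    then show ?thesis using simulation_blame prec.Proj2 Proj2.hyps(1) by blast
  next
    case head
    then obtain V where V: "is_value S V" "steps S [] (TProd A B) M V"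
        "prec S [] [] V (TProd A B) M' (TProd A' B')"
      using catch_up Proj2.hyps(1) by blast
    show ?thesis
      using proj2_simulation[OF V(3) refl refl V(1) head Proj2.prems] M[OF V(2)]
      by (meson rtranclp_trans)
  qed
next
  case (InL M A M' A' B B')
  from InL.prems show ?case
  proof (cases rule: step_InLE)
    case (frame C M2')
    then obtain M2 where "steps S [] A M M2" "prec S [] [] M2 A M2' A'"
      using InL.hyps(2) by blast
    then show ?thesis using InL.hyps(3) frame(3)
      by (blast intro: steps_frame typed_frame.InL prec.InL)
  next
    case (blame l)
    then show ?thesis using simulation_blame prec.InL InL.hyps(1,3) by blast
  qed
next
  case (InR M B M' B' A A')
  from InR.prems show ?case
  proof (cases rule: step_InRE)
    case (frame C M2')
    then obtain M2 where "steps S [] B M M2" "prec S [] [] M2 B M2' B'"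
      using InR.hyps(2) by blast
    then show ?thesis using InR.hyps(3) frame(3)
      by (blast intro: steps_frame typed_frame.InR prec.InR)
  next
    case (blame l)
    then show ?thesis using simulation_blame prec.InR InR.hyps(1,3) by blast
  qed
next
  case (Case L A1 A2 L' A1' A2' M B M' B' N1 N1')
  note typed = Case.hyps(1,5,6)[THEN prec_typed]
  note prec_Case = prec.Case[OF _ Case.hyps(3,4,5,6)]
  have L: "steps S [] B (Case L M N1) (Case L2 M N1)" if "steps S [] (TSum A1 A2) L L2" for L2
    using that typed by (blast intro: steps_frame typed_frame.Case)
  from Case.prems show ?case
  proof (cases rule: step_CaseE)
    case (frame C1 C2 L2')
    have "typed S [] L' (TSum C1 C2)" using frame(1) step_typed by blast
    then have "TSum C1 C2 = TSum A1' A2'" using typed typed_unique by blast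
    then show ?thesis using Case.hyps(2) frame L prec_Case by blast
  next
    case (blame l)
    then show ?thesis using simulation_blame prec_Case Case.hyps(1) by blast
  next
    case head
    then obtain V where V: "is_value S V" "steps S [] (TSum A1 A2) L V"
        "prec S [] [] V (TSum A1 A2) L' (TSum A1' A2')"
      using catch_up Case.hyps(1) by blast
    show ?thesis
      using case_simulation[OF V(3) refl refl V(1) head Case.hyps(5,6) Case.prems] L[OF V(2)]
      by (meson rtranclp_trans)
  qed
next
  case (Cast M A M' A' c B c' B')
  have M: "steps S [] B (Cast M c) (Cast M2 c)" if "steps S [] A M M2" for M2
    using that Cast.hyps(3) by (blast intro: steps_frame typed_frame.Cast)
  from Cast.prems show ?case
  proof (cases rule: step_CastE)
    case (frame C M2')
    then have "C = A'" using Cast.hyps(4) by (simp add: is_cast_def)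
    then obtain M2 where "steps S [] A M M2" "prec S [] [] M2 A M2' A'"
      using Cast.hyps(2) frame(2) by blast
    then show ?thesis using M prec.Cast[OF _ Cast.hyps(3-6)] frame(3) by blast
  next
    case (blame l)
    then show ?thesis using simulation_blame[OF prec.Cast[OF Cast.hyps(1,3-6)]] by blast
  next
    case (cast a)
    then obtain V where V: "is_value S V" "steps S [] A M V" "prec S [] [] V A M' A'"
      using catch_up Cast.hyps(1) by blast
    \<comment> \<open>Whether \<open>c\<close> on the left is active or inert need not be examined:
      \<open>cast_apply_cast\<close> covers the whole reduction of \<open>Cast V c\<close>.\<close>
    show ?thesis
      using cast_apply_cast[OF prec_valuesI[OF V(3,1) cast(1)] Cast.hyps(3,4) cast(2) Cast.hyps(6)]
        M[OF V(2)] cast(3)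
      by (meson rtranclp_trans)
  next
    case wrap
    then obtain V where V: "is_value S V" "steps S [] A M V" "prec S [] [] V A M' A'"
      using catch_up Cast.hyps(1) by blast
    show ?thesis
      using cast_wrap[OF prec_valuesI[OF V(3,1) wrap(1)] Cast.hyps(3,4) wrap(2) Cast.hyps(6)]
        M[OF V(2)] wrap(3)
      by (meson rtranclp_trans)
  qed
next
  case (CastL M A M' A' c B)
  then obtain M2 where "steps S [] A M M2" "prec S [] [] M2 A N' A'" by blast
  with prec.CastL[OF _ CastL.hyps(3-5)] CastL.hyps(3) show ?case
    by (blast intro: steps_frame typed_frame.Cast)
next
  case (CastR M A M' A' c' B')
  from CastR.prems show ?case
  proof (cases rule: step_CastE)
    case (frame C M2')
    then have "C = A'" using CastR.hyps(3) by (simp add: is_cast_def)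
    then show ?thesis using CastR.hyps(2) prec.CastR[OF _ CastR.hyps(3-5)] frame(2,3) by blast
  next
    case (blame l)
    then show ?thesis using simulation_blame[OF prec.CastR[OF CastR.hyps(1,3-5)]] by blast
  next
    case (cast a)
    then obtain V where V: "is_value S V" "steps S [] A M V" "prec S [] [] V A M' A'"
      using catch_up CastR.hyps(1) by blast
    show ?thesis
      using apply_cast_right[OF prec_valuesI[OF V(3,1) cast(1)] CastR.hyps(3) cast(2) CastR.hyps(5)]
        V(2) cast(3)
      by blast
  next
    case wrap
    then obtain V where V: "is_value S V" "steps S [] A M V" "prec S [] [] V A M' A'"
      using catch_up CastR.hyps(1) by blast
    show ?thesis
      using wrap_right[OF prec_valuesI[OF V(3,1) wrap(1)] CastR.hyps(3) wrap(2) CastR.hyps(5)]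
        V(2) wrap(3)
      by blast
  qed
next
  case (Wrap M A M' A' i i' B B')
  from Wrap.prems show ?case
  proof (cases rule: step_WrapE)
    case (frame C M2')
    then have "C = A'" using Wrap.hyps(7) by (simp add: is_cast_def)
    then obtain M2 where M2: "steps S [] A M M2" "prec S [] [] M2 A M2' A'"
      using Wrap.hyps(2) frame(2) by blast
    have "steps S [] B (Wrap M i) (Wrap M2 i)"
      using M2 Wrap.hyps(3,6) by (blast intro: steps_frame typed_frame.Wrap)
    then show ?thesis using prec.Wrap[OF M2(2) Wrap.hyps(3-8)] frame(3) by blast
  next
    case (blame l)
    then show ?thesis using simulation_blame[OF prec.Wrap[OF Wrap.hyps(1,3-8)]] by blast
  qed
next
  case (WrapL M A M' A' i B)
  then obtain M2 where "steps S [] A M M2" "prec S [] [] M2 A N' A'" by blast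
  with prec.WrapL[OF _ WrapL.hyps(3-5)] WrapL.hyps(3,4) show ?case
    by (blast intro: steps_frame typed_frame.Wrap)
next
  case (WrapR M A M' A' i' B')
  from WrapR.prems show ?case
  proof (cases rule: step_WrapE)
    case (frame C M2')
    then have "C = A'" using WrapR.hyps(4) by (simp add: is_cast_def)
    then show ?thesis using WrapR.hyps(2) prec.WrapR[OF _ WrapR.hyps(3-6)] frame(2,3) by blast
  next
    case (blame l)
    then show ?thesis using simulation_blame[OF prec.WrapR[OF WrapR.hyps(1,3-6)]] by blast
  qed
qed (simp_all add: no_step_leaf)

end

theorem lemma16:
  fixes S :: "('c, 'a, 'x, 'l) cast_struct_prec"
    and M1 M1' M2' :: "('c, 'l) tm"
    and A A' :: ty
  assumes "cast_struct_with_precision S"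
    and "typed S [] M1 A"
    and "typed S [] M1' A'"
    and "typed S [] M2' A'"
    and "prec S [] [] M1 A M1' A'"
    and "step S [] A' M1' M2'"
  shows "\<exists>M2. typed S [] M2 A \<and> steps S [] A M1 M2 \<and> prec S [] [] M2 A M2' A'"
proof -
  interpret cast_struct_with_precision S by fact
  from simulation[OF assms(5,6)] show ?thesis by (blast dest: prec_typed)
qed

end
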